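(* Let $H=(\sigma,\alpha)$ be a collection of hypermaps on the set $\{1,2,\ldots,n\}$ and assume that $(1,2,\ldots,m)$ is a cycle of $\alpha$ of length $m\geq 2$. For $k\in\{1,\ldots,m\}$ let $\phi_k(H)=(\sigma_k,\alpha_k)$ be the collection of hypermaps defined by: $\sigma_k=\sigma$ if $1$ and $k$ belong to the same cycle of $\sigma$, and $\sigma_k=(1,k)\sigma$ otherwise; and $\alpha_k$ is obtained from $\alpha$ by replacing the cycle $(1,2,\ldots,m)$ with $(1)(2,\ldots,m)$ if $k\in\{1,2\}$, and with $(1)(2,\ldots,k-1)(k,\ldots,m)$ if $k\notin\{1,2\}$. Then the Whitney polynomial of $H$ satisfies $$R(H;u,v)=\sum_{k=1}^m R(\phi_k(H);u,v)\cdot w_k,$$ where each $w_k$ is a monomial from the set $\{1,u,v,uv\}$, given by $$w_k=\begin{cases} u^{\kappa(\phi_k(H))-\kappa(H)}\,v & \text{if } k\neq 1 \text{ and } 1 \text{ and } k \text{ belong to the same cycle of } \sigma;\\ u^{\kappa(\phi_k(H))-\kappa(H)} & \text{otherwise.}\end{cases}$$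
   Context: Permutations act on a finite set and are composed from right to left: $(\pi\rho)(i)=\pi(\rho(i))$. The symbol $(i,j)$ denotes a transposition, and $z(\pi)$ is the number of cycles of $\pi$ (fixed points included). A collection of hypermaps $(\sigma,\alpha)$ on a finite set of points is an ordered pair of permutations of that set. Its connected components are the orbits of the permutation group generated by $\sigma$ and $\alpha$; their number is $\kappa(\sigma,\alpha)$. A permutation $\beta$ is a refinement of $\alpha$ (written $\beta\le\alpha$) if $\beta$ is obtained by replacing each cycle $\alpha_i$ of $\alpha$ by a permutation $\beta_i$ acting on the same set of $n_i$ points in such a way that the genus $g(\alpha_i,\beta_i)$ is $0$, that is, $z(\beta_i)+z(\beta_i^{-1}\alpha_i)=n_i+1$ (equivalently, the cycles of $\beta_i$ form a noncrossing partition in the circular order of $\alpha_i$, each listed in that circular order). The Whitney polynomial of a collection of hypermaps $(\sigma,\alpha)$ on $n$ points is $$R(\sigma,\alpha;u,v)=\sum_{\beta\leq\alpha}u^{\kappa(\sigma,\beta)-\kappa(\sigma,\alpha)}\,v^{\kappa(\sigma,\beta)+n-z(\beta)-z(\sigma)}.$$ *)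

theory Defs
  imports "HOL-Algebra.Sym_Groups" "HOL-Algebra.Group_Action" "HOL-Combinatorics.Orbits"
begin

section \<open>Collections of hypermaps and the Whitney polynomial\<close>

text \<open>A collection of hypermaps on \<open>{1..n}\<close> is a pair of permutations of \<open>{1..n}\<close>;
  permutations are total functions fixing everything outside the set, and the product of
  permutations is \<open>\<circ>\<close>, i.e. it is taken from right to left.\<close>

type_synonym hypermaps = "(nat \<Rightarrow> nat) \<times> (nat \<Rightarrow> nat)"

fun collection_of_hypermaps :: "nat \<Rightarrow> hypermaps \<Rightarrow> bool" where
  "collection_of_hypermaps n (\<sigma>, \<alpha>) \<longleftrightarrow> \<sigma> permutes {1..n} \<and> \<alpha> permutes {1..n}"

text \<open>The underlying sets of the cycles of a permutation \<open>p\<close> of \<open>S\<close> (fixed points included) and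
  the number \<open>z(p)\<close> of cycles. The set \<open>S\<close> has to be given since \<open>p\<close> fixes all points outside it.\<close>

definition cycle_sets :: "'a set \<Rightarrow> ('a \<Rightarrow> 'a) \<Rightarrow> 'a set set" where
  "cycle_sets S p = {Orbits.orbit p x | x. x \<in> S}"

definition num_cycles :: "'a set \<Rightarrow> ('a \<Rightarrow> 'a) \<Rightarrow> nat" where
  "num_cycles S p = card (cycle_sets S p)"

definition same_cycle :: "('a \<Rightarrow> 'a) \<Rightarrow> 'a \<Rightarrow> 'a \<Rightarrow> bool" where
  "same_cycle p x y \<longleftrightarrow> y \<in> Orbits.orbit p x"

text \<open>The cycle \<open>(c\<^sub>1, \<dots>, c\<^sub>r)\<close> is a cycle of \<open>p\<close>.\<close>

definition has_cycle :: "('a \<Rightarrow> 'a) \<Rightarrow> 'a list \<Rightarrow> bool" where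
  "has_cycle p cs \<longleftrightarrow> cs \<noteq> [] \<and> distinct cs \<and> (\<forall>x\<in>set cs. p x = cycle_of_list cs x)"

fun kappa :: "nat \<Rightarrow> hypermaps \<Rightarrow> nat" where
  "kappa n (\<sigma>, \<alpha>) =
     card (orbits (sym_group n \<lparr>carrier := generate (sym_group n) {\<sigma>, \<alpha>}\<rparr>) {1..n} (\<lambda>g. g))"

text \<open>\<open>refines S \<beta> \<alpha>\<close> is \<open>\<beta> \<le> \<alpha>\<close> for permutations of \<open>S\<close>. Here \<open>perm_restrict \<alpha> C\<close> is the cycle
  \<open>\<alpha>\<^sub>i\<close> of \<open>\<alpha>\<close> on the set \<open>C\<close>, \<open>perm_restrict \<beta> C\<close> is the permutation \<open>\<beta>\<^sub>i\<close> replacing it, and the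
  equation says that the hypermap \<open>(\<alpha>\<^sub>i, \<beta>\<^sub>i)\<close> on \<open>C\<close> has genus zero.\<close>

definition refines :: "'a set \<Rightarrow> ('a \<Rightarrow> 'a) \<Rightarrow> ('a \<Rightarrow> 'a) \<Rightarrow> bool" where
  "refines S \<beta> \<alpha> \<longleftrightarrow> \<beta> permutes S \<and>
     (\<forall>C\<in>cycle_sets S \<alpha>. perm_restrict \<beta> C permutes C \<and>
        num_cycles C (perm_restrict \<beta> C)
          + num_cycles C (inv' (perm_restrict \<beta> C) \<circ> perm_restrict \<alpha> C) = card C + 1)"

text \<open>\<open>R(\<sigma>, \<alpha>; u, v)\<close>. The arguments \<open>u, v\<close> range over an arbitrary commutative ring, so that they
  may be taken to be the two indeterminates of a polynomial ring. The subtractions of natural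
  numbers in the exponents are never truncated, see \<open>kappa_refines_le\<close> and
  \<open>num_cycles_add_le_kappa\<close> below.\<close>

fun whitney :: "nat \<Rightarrow> hypermaps \<Rightarrow> 'r::comm_ring_1 \<Rightarrow> 'r \<Rightarrow> 'r" where
  "whitney n (\<sigma>, \<alpha>) u v =
     (\<Sum>\<beta> | refines {1..n} \<beta> \<alpha>.
        u ^ (kappa n (\<sigma>, \<beta>) - kappa n (\<sigma>, \<alpha>)) *
        v ^ (kappa n (\<sigma>, \<beta>) + n - (num_cycles {1..n} \<beta> + num_cycles {1..n} \<sigma>)))"

section \<open>The operations \<open>\<phi>\<^sub>k\<close>\<close>

fun phi :: "nat \<Rightarrow> nat \<Rightarrow> hypermaps \<Rightarrow> hypermaps" where
  "phi m k (\<sigma>, \<alpha>) =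
     (if same_cycle \<sigma> 1 k then \<sigma> else transpose 1 k \<circ> \<sigma>,
      \<lambda>x. if x \<in> {1..m}
          then (if k \<in> {1, 2} then cycle_of_list [2..<Suc m] x
                else (cycle_of_list [2..<k] \<circ> cycle_of_list [k..<Suc m]) x)
          else \<alpha> x)"

text \<open>The monomial \<open>w\<^sub>k\<close>. Its exponent is not truncated either, see \<open>kappa_le_kappa_phi\<close>.\<close>

fun weight :: "nat \<Rightarrow> nat \<Rightarrow> nat \<Rightarrow> hypermaps \<Rightarrow> 'r::comm_ring_1 \<Rightarrow> 'r \<Rightarrow> 'r" where
  "weight n m k (\<sigma>, \<alpha>) u v =
     (if k \<noteq> 1 \<and> same_cycle \<sigma> 1 k
      then u ^ (kappa n (phi m k (\<sigma>, \<alpha>)) - kappa n (\<sigma>, \<alpha>)) * v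
      else u ^ (kappa n (phi m k (\<sigma>, \<alpha>)) - kappa n (\<sigma>, \<alpha>)))"

section \<open>The exponents are nonnegative\<close>

definition graph_of :: "('a \<Rightarrow> 'a) \<Rightarrow> ('a \<times> 'a) set" where
  "graph_of p = {(x, p x) | x. True}"

definition conn :: "('a \<times> 'a) set \<Rightarrow> ('a \<times> 'a) set" where
  "conn E = (E \<union> E\<inverse>)\<^sup>*"

definition comps :: "'a set \<Rightarrow> ('a \<times> 'a) set \<Rightarrow> 'a set set" where
  "comps S E = (\<lambda>x. conn E `` {x}) ` S"

lemma conn_refl [simp]: "(x, x) \<in> conn E"
  by (simp add: conn_def)

lemma conn_sym: "(x, y) \<in> conn E \<Longrightarrow> (y, x) \<in> conn E"
  unfolding conn_def using sym_rtrancl[of "E \<union> E\<inverse>"] by (auto simp: sym_def)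

lemma conn_trans: "(x, y) \<in> conn E \<Longrightarrow> (y, z) \<in> conn E \<Longrightarrow> (x, z) \<in> conn E"
  unfolding conn_def by (rule rtrancl_trans)

lemma conn_edge: "e \<in> E \<Longrightarrow> e \<in> conn E"
  unfolding conn_def by auto

lemma conn_least: "E \<subseteq> conn E' \<Longrightarrow> conn E \<subseteq> conn E'"
proof -
  assume "E \<subseteq> conn E'"
  then have "E \<union> E\<inverse> \<subseteq> (E' \<union> E'\<inverse>)\<^sup>*"
    using conn_sym[of _ _ E'] by (auto simp: conn_def)
  then show ?thesis
    unfolding conn_def by (metis rtrancl_idemp rtrancl_mono)
qed

lemma conn_class_eq: "(x, y) \<in> conn E \<Longrightarrow> conn E `` {x} = conn E `` {y}"
  using conn_sym conn_trans by fast

lemma card_comps_antimono: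
  assumes "finite S" "E \<subseteq> conn E'"
  shows "card (comps S E') \<le> card (comps S E)"
proof -
  have eq: "conn E' `` (conn E `` {x}) = conn E' `` {x}" for x
    using conn_least[OF assms(2)] conn_trans[of _ _ E'] by fastforce
  have "comps S E' = (\<lambda>c. conn E' `` c) ` comps S E"
    unfolding comps_def by (simp add: image_image eq)
  then show ?thesis
    using assms(1) card_image_le[of "comps S E"] by (simp add: comps_def)
qed

lemma card_comps_insert:
  assumes S: "finite S" and a: "a \<in> S"
  shows "card (comps S E) \<le> card (comps S (insert (a, b) E)) + 1"
proof -
  let ?E = "insert (a, b) E"
  let ?N = "(\<lambda>x. conn E `` {x}) ` {x\<in>S. (x, a) \<notin> conn E \<and> (x, b) \<notin> conn E}"
  have mono: "conn E \<subseteq> conn ?E"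
    by (rule conn_least) (auto intro: conn_edge)
  have far: "(x, y) \<in> conn E"
    if "(x, y) \<in> conn ?E" "(x, a) \<notin> conn E" "(x, b) \<notin> conn E" for x y
    using that(1) unfolding conn_def[of ?E]
  proof (induction rule: rtrancl_induct)
    case base
    show ?case by simp
  next
    case (step y z)
    then have "(y, z) \<in> E \<union> E\<inverse>"
      using that(2,3) by auto
    then have "(y, z) \<in> conn E"
      by (auto simp: conn_def)
    then show ?case
      using step.IH conn_trans by fast
  qed
  have eq: "conn ?E `` {x} = conn E `` {x}" if "(x, a) \<notin> conn E" "(x, b) \<notin> conn E" for x
    using far that mono by blast
  have finN: "finite ?N" using S by simp
  have "comps S E \<subseteq> {conn E `` {a}, conn E `` {b}} \<union> ?N"
  proof
    fix c assume "c \<in> comps S E"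
    then obtain x where x: "x \<in> S" "c = conn E `` {x}"
      by (auto simp: comps_def)
    then show "c \<in> {conn E `` {a}, conn E `` {b}} \<union> ?N"
      using conn_class_eq[of x a E] conn_class_eq[of x b E] by auto
  qed
  then have "card (comps S E) \<le> card ({conn E `` {a}, conn E `` {b}} \<union> ?N)"
    using finN by (intro card_mono) auto
  also have "\<dots> \<le> 2 + card ?N"
    by (rule order_trans[OF card_Un_le]) (simp add: card_insert_if)
  finally have le: "card (comps S E) \<le> 2 + card ?N" .
  have "conn ?E `` {a} \<notin> ?N"
  proof
    assume "conn ?E `` {a} \<in> ?N"
    then obtain x where "(x, a) \<notin> conn E" "conn ?E `` {a} = conn E `` {x}"
      by auto
    moreover have "a \<in> conn ?E `` {a}" by simp
    ultimately show False by auto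
  qed
  moreover have "insert (conn ?E `` {a}) ?N \<subseteq> comps S ?E"
  proof -
    have "?N \<subseteq> comps S ?E"
    proof
      fix c assume "c \<in> ?N"
      then obtain x where x: "x \<in> S" "(x, a) \<notin> conn E" "(x, b) \<notin> conn E" "c = conn E `` {x}"
        by auto
      then have "c = conn ?E `` {x}" using eq by simp
      then show "c \<in> comps S ?E" using x(1) by (auto simp: comps_def)
    qed
    then show ?thesis using a by (auto simp: comps_def)
  qed
  then have "card (insert (conn ?E `` {a}) ?N) \<le> card (comps S ?E)"
    using S by (intro card_mono) (auto simp: comps_def)
  ultimately have "card ?N + 1 \<le> card (comps S ?E)"
    using finN by simp
  then show ?thesis using le by linarith
qed

lemma card_comps_Un:
  assumes "finite F" "finite S" "fst ` F \<subseteq> S"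
  shows "card (comps S E) \<le> card (comps S (E \<union> F)) + card F"
  using assms(1,3)
proof (induction F rule: finite_induct)
  case empty
  then show ?case by simp
next
  case (insert e F)
  obtain a b where e: "e = (a, b)" by fastforce
  have "card (comps S (E \<union> F)) \<le> card (comps S (insert e (E \<union> F))) + 1"
    unfolding e using insert.prems e by (intro card_comps_insert assms) auto
  then show ?case using insert by simp
qed

lemma orbit_eq_conn:
  assumes "permutation p"
  shows "Orbits.orbit p x = conn (graph_of p) `` {x}"
proof
  show "Orbits.orbit p x \<subseteq> conn (graph_of p) `` {x}"
  proof
    fix y assume "y \<in> Orbits.orbit p x"
    then show "y \<in> conn (graph_of p) `` {x}"
    proof induction
      case base
      then show ?case by (auto intro!: conn_edge simp: graph_of_def)
    next
      case (step y)
      have "(y, p y) \<in> conn (graph_of p)" by (auto intro!: conn_edge simp: graph_of_def)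
      then show ?case using step conn_trans by fast
    qed
  qed
next
  show "conn (graph_of p) `` {x} \<subseteq> Orbits.orbit p x"
  proof
    fix y assume "y \<in> conn (graph_of p) `` {x}"
    then have "(x, y) \<in> (graph_of p \<union> (graph_of p)\<inverse>)\<^sup>*" by (simp add: conn_def)
    then show "y \<in> Orbits.orbit p x"
    proof (induction rule: rtrancl_induct)
      case base
      show ?case using assms by (rule permutation_self_in_orbit)
    next
      case (step y z)
      from step.hyps(2) consider "z = p y" | "y = p z"
        by (auto simp: graph_of_def)
      then show ?case
      proof cases
        case 1
        then show ?thesis using step.IH by (auto intro: orbit.step)
      next
        case 2
        then have "z = inv' p y"
          using assms by (simp add: permutation_bijective bij_is_inj)
        then show ?thesis
          using step.IH orbit_inv_eq[OF assms, of x] by (metis orbit.step)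
      qed
    qed
  qed
qed

lemma cycle_sets_eq_comps: "permutation p \<Longrightarrow> cycle_sets S p = comps S (graph_of p)"
  by (auto simp: cycle_sets_def comps_def orbit_eq_conn)

lemma kappa_eq_comps:
  assumes "\<sigma> permutes {1..n}" "\<alpha> permutes {1..n}"
  shows "kappa n (\<sigma>, \<alpha>) = card (comps {1..n} (graph_of \<sigma> \<union> graph_of \<alpha>))"
proof -
  let ?E = "graph_of \<sigma> \<union> graph_of \<alpha>"
  let ?G = "generate (sym_group n) {\<sigma>, \<alpha>}"
  have inv_eq: "m_inv (sym_group n) h = inv' h" if "h \<in> {\<sigma>, \<alpha>}" for h
    using that assms by (intro sym_group_inv_equality) (auto simp: sym_group_carrier)
  have bij: "bij h" if "h \<in> {\<sigma>, \<alpha>}" for h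
    using that assms by (auto intro: permutes_bij)
  have fwd: "(x, g x) \<in> conn ?E" if "g \<in> ?G" for g x
    using that
  proof (induction arbitrary: x)
    case one
    show ?case by (simp add: sym_group_one)
  next
    case (incl h)
    then show ?case by (auto intro!: conn_edge simp: graph_of_def)
  next
    case (inv h)
    have "h (inv' h x) = x" using bij[OF inv] by (simp add: bij_is_surj surj_f_inv_f)
    then have "(inv' h x, x) \<in> ?E" using inv by (force simp: graph_of_def)
    then show ?case using inv_eq[OF inv] conn_edge conn_sym by metis
  next
    case (eng g h)
    have "(x, h x) \<in> conn ?E" "(h x, g (h x)) \<in> conn ?E" by (rule eng.IH)+
    then show ?case using conn_trans by (fastforce simp: sym_group_mult)
  qed
  have bwd: "\<exists>g\<in>?G. y = g x" if "(x, y) \<in> conn ?E" for x y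
    using that unfolding conn_def
  proof (induction rule: rtrancl_induct)
    case base
    show ?case using generate.one[of "sym_group n" "{\<sigma>, \<alpha>}"]
      by (intro bexI[of _ id]) (simp_all add: sym_group_one)
  next
    case (step y z)
    then obtain g where g: "g \<in> ?G" "y = g x" by auto
    from step.hyps(2) obtain h where h: "h \<in> {\<sigma>, \<alpha>}" "z = h y \<or> y = h z"
      by (auto simp: graph_of_def)
    then have "z = h y \<or> z = inv' h y"
      using bij[OF h(1)] by (auto simp: bij_is_inj)
    then obtain h' where h': "h' \<in> ?G" "z = h' y"
      using generate.incl[OF h(1), of "sym_group n"] generate.inv[OF h(1), of "sym_group n"]
        inv_eq[OF h(1)] by metis
    have "h' \<circ> g \<in> ?G"
      using generate.eng[OF h'(1) g(1)] by (simp add: sym_group_mult)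
    then show ?case using h'(2) g(2) by (intro bexI[of _ "h' \<circ> g"]) auto
  qed
  have "{g x | g. g \<in> ?G} = conn ?E `` {x}" for x
    using fwd bwd by blast
  then show ?thesis
    by (auto simp: orbits_def Group_Action.orbit_def comps_def intro!: arg_cong[of _ _ card])
qed

lemma num_cycles_add_le_kappa:
  assumes "\<sigma> permutes {1..n}" "\<beta> permutes {1..n}"
  shows "num_cycles {1..n} \<beta> + num_cycles {1..n} \<sigma> \<le> kappa n (\<sigma>, \<beta>) + n"
proof -
  let ?S = "{1..n}"
  let ?O = "Orbits.orbit \<beta>"
  have perm: "permutation \<sigma>" "permutation \<beta>"
    using assms by (auto simp: permutation_permutes)
  define T where "T = {x\<in>?S. x = Min (?O x)}"
  define F where "F = (\<lambda>x. (x, \<beta> x)) ` (?S - T)"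
  have fin: "finite (?O x)" for x
    using perm(2) by (intro finite_orbit permutation_self_in_orbit)
  have min_in: "Min (?O x) \<in> ?O x" for x
    using fin by (intro Min_in) (auto simp: orbit_nonempty)
  have same: "?O y = ?O x" if "y \<in> ?O x" for x y
    using that conn_class_eq by (force simp: orbit_eq_conn[OF perm(2)])
  have "cycle_sets ?S \<beta> \<subseteq> ?O ` T"
  proof
    fix c assume "c \<in> cycle_sets ?S \<beta>"
    then obtain x where x: "x \<in> ?S" "c = ?O x" by (auto simp: cycle_sets_def)
    let ?y = "Min (?O x)"
    have eq: "?O ?y = ?O x" using same min_in by blast
    have "?y \<in> ?S"
      using permutes_orbit_subset[OF assms(2) x(1)] min_in by blast
    then have "?y \<in> T" using eq by (simp add: T_def)
    then show "c \<in> ?O ` T" using x(2) eq by blast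
  qed
  then have "num_cycles ?S \<beta> \<le> card T"
    unfolding num_cycles_def by (rule surj_card_le[rotated]) (simp add: T_def)
  moreover have "card F \<le> card (?S - T)"
    unfolding F_def by (rule card_image_le) simp
  moreover have "card (?S - T) + card T = n"
  proof -
    have "T \<subseteq> ?S" "finite T" by (auto simp: T_def)
    then show ?thesis using card_Diff_subset[of T ?S] card_mono[of ?S T] by simp
  qed
  moreover have "card (comps ?S (graph_of \<sigma>)) \<le> card (comps ?S (graph_of \<sigma> \<union> F)) + card F"
    by (rule card_comps_Un) (auto simp: F_def)
  moreover have "card (comps ?S (graph_of \<sigma> \<union> F)) \<le> card (comps ?S (graph_of \<sigma> \<union> graph_of \<beta>))"
  proof (rule card_comps_antimono)
    have F: "(z, \<beta> z) \<in> conn F" if "z \<notin> T" for z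
    proof (cases "z \<in> ?S")
      case True
      then show ?thesis using that by (auto intro!: conn_edge simp: F_def)
    next
      case False
      then show ?thesis using permutes_not_in[OF assms(2)] by simp
    qed
    have "(y, \<beta> y) \<in> conn F" for y
    proof (cases "y \<in> T")
      case True
      have "(\<beta> y, z) \<in> conn F" if "z \<in> ?O y" for z
        using that
      proof induction
        case base
        show ?case by simp
      next
        case (step z)
        show ?case
        proof (cases "z = y")
          case False
          have "z \<notin> T"
            using False True same[OF step.hyps] by (auto simp: T_def)
          then show ?thesis using F step.IH conn_trans by fast
        qed simp
      qed
      then show ?thesis
        using permutation_self_in_orbit[OF perm(2)] conn_sym by fast
    qed (rule F)
    moreover have "conn F \<subseteq> conn (graph_of \<sigma> \<union> F)" 
      by (rule conn_least) (auto intro: conn_edge)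
    ultimately show "graph_of \<sigma> \<union> graph_of \<beta> \<subseteq> conn (graph_of \<sigma> \<union> F)"
      using conn_edge[of _ "graph_of \<sigma> \<union> F"] by (auto simp: graph_of_def)
  qed simp
  ultimately show ?thesis
    unfolding kappa_eq_comps[OF assms] num_cycles_def cycle_sets_eq_comps[OF perm(1)]
    by linarith
qed

lemma kappa_mono:
  assumes "\<sigma> permutes {1..n}" "\<alpha> permutes {1..n}" "\<sigma>' permutes {1..n}" "\<alpha>' permutes {1..n}"
    and "\<And>x. (x, \<sigma>' x) \<in> conn (graph_of \<sigma> \<union> graph_of \<alpha>)"
    and "\<And>x. (x, \<alpha>' x) \<in> conn (graph_of \<sigma> \<union> graph_of \<alpha>)"
  shows "kappa n (\<sigma>, \<alpha>) \<le> kappa n (\<sigma>', \<alpha>')"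
  unfolding kappa_eq_comps[OF assms(1,2)] kappa_eq_comps[OF assms(3,4)]
  by (rule card_comps_antimono) (use assms(5,6) in \<open>auto simp: graph_of_def\<close>)

lemma kappa_refines_le:
  assumes "\<sigma> permutes {1..n}" "\<alpha> permutes {1..n}" "refines {1..n} \<beta> \<alpha>"
  shows "kappa n (\<sigma>, \<alpha>) \<le> kappa n (\<sigma>, \<beta>)"
proof (rule kappa_mono[OF assms(1,2,1)])
  let ?E = "graph_of \<sigma> \<union> graph_of \<alpha>"
  show \<beta>: "\<beta> permutes {1..n}" using assms(3) by (simp add: refines_def)
  show "(x, \<sigma> x) \<in> conn ?E" for x
    by (auto intro!: conn_edge simp: graph_of_def)
  have perm: "permutation \<alpha>" using assms(2) by (auto simp: permutation_permutes)
  show "(x, \<beta> x) \<in> conn ?E" for x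
  proof (cases "x \<in> {1..n}")
    case True
    let ?C = "Orbits.orbit \<alpha> x"
    have "?C \<in> cycle_sets {1..n} \<alpha>" using True by (auto simp: cycle_sets_def)
    then have "perm_restrict \<beta> ?C permutes ?C" using assms(3) by (simp add: refines_def)
    moreover have "x \<in> ?C" using perm by (rule permutation_self_in_orbit)
    ultimately have "\<beta> x \<in> ?C" by (metis permutes_in_image perm_restrict_simps(1))
    then have "(x, \<beta> x) \<in> conn (graph_of \<alpha>)" by (simp add: orbit_eq_conn[OF perm])
    moreover have "conn (graph_of \<alpha>) \<subseteq> conn ?E" by (rule conn_least) (auto intro: conn_edge)
    ultimately show ?thesis by blast
  qed (use \<beta> in \<open>simp add: permutes_not_in\<close>)
qed

lemma collection_of_hypermaps_phi:
  assumes H: "collection_of_hypermaps n (\<sigma>, \<alpha>)" and cyc: "has_cycle \<alpha> [1..<Suc m]"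
    and k: "k \<in> {1..m}" and m: "m \<ge> 2"
  shows "collection_of_hypermaps n (phi m k (\<sigma>, \<alpha>))"
proof -
  have s: "\<sigma> permutes {1..n}" and a: "\<alpha> permutes {1..n}" using H by auto
  let ?c = "cycle_of_list [1..<Suc m]"
  let ?d = "if k \<in> {1, 2} then cycle_of_list [2..<Suc m]
            else cycle_of_list [2..<k] \<circ> cycle_of_list [k..<Suc m]"
  have \<alpha>c: "\<alpha> x = ?c x" if "x \<in> {1..m}" for x
    using cyc that unfolding has_cycle_def by (auto simp del: upt_Suc)
  have c: "?c permutes {1..m}"
    using cycle_permutes[of "[1..<Suc m]"] by (simp add: atLeastLessThanSuc_atLeastAtMost del: upt_Suc)
  have sub: "cycle_of_list [i..<j] permutes {1..m}" if "1 \<le> i" "j \<le> Suc m" for i j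
    by (rule permutes_subset[OF cycle_permutes]) (use that in auto)
  have d: "?d permutes {1..m}"
  proof (cases "k \<in> {1, 2}")
    case True
    then show ?thesis using sub[of 2 "Suc m"] by (simp del: upt_Suc)
  next
    case False
    then show ?thesis using k sub[of 2 k] sub[of k "Suc m"]
      by (auto simp del: upt_Suc intro!: permutes_compose)
  qed
  have mn: "m \<le> n"
  proof (rule ccontr)
    assume "\<not> m \<le> n"
    then have "?c m = m" using \<alpha>c[of m] a m by (simp add: permutes_not_in del: upt_Suc)
    moreover have "?c (last [1..<Suc m]) = hd [1..<Suc m]"
    proof -
      have "map (?c ^^ 1) [1..<Suc m] = rotate 1 [1..<Suc m]"
        by (rule cyclic_rotation) simp
      then have "last (map ?c [1..<Suc m]) = last (rotate1 [1..<Suc m])" by (simp del: upt_Suc)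
      moreover have "[1..<Suc m] \<noteq> []" using m by simp
      ultimately show ?thesis
        by (simp add: last_map rotate1_hd_tl del: upt_Suc)
    qed
    ultimately show False using m by simp
  qed
  have "inv' ?c \<circ> \<alpha> permutes {1..n}"
    by (rule permutes_compose[OF a permutes_subset[OF permutes_inv[OF c]]]) (use mn in auto)
  then have "?d \<circ> (inv' ?c \<circ> \<alpha>) permutes {1..n}"
    by (rule permutes_compose[OF _ permutes_subset[OF d]]) (use mn in auto)
  moreover have "?d \<circ> (inv' ?c \<circ> \<alpha>) = snd (phi m k (\<sigma>, \<alpha>))"
  proof
    fix x
    show "(?d \<circ> (inv' ?c \<circ> \<alpha>)) x = snd (phi m k (\<sigma>, \<alpha>)) x"
    proof (cases "x \<in> {1..m}")
      case True
      then have "inv' ?c (\<alpha> x) = x"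
        using \<alpha>c permutes_inj[OF c] by (simp del: upt_Suc)
      then show ?thesis using True by (simp del: upt_Suc)
    next
      case False
      have "\<alpha> ` {1..m} = ?c ` {1..m}" using \<alpha>c by (rule image_cong[OF refl])
      then have "\<alpha> ` {1..m} = {1..m}" using permutes_image[OF c] by simp
      then have "\<alpha> x \<notin> {1..m}"
        using False permutes_inj[OF a] by (metis inj_image_mem_iff)
      then have "inv' ?c (\<alpha> x) = \<alpha> x" "?d (\<alpha> x) = \<alpha> x"
        using permutes_not_in[OF permutes_inv[OF c]] permutes_not_in[OF d] by blast+
      then show ?thesis using False by (auto simp del: upt_Suc)
    qed
  qed
  ultimately have "snd (phi m k (\<sigma>, \<alpha>)) permutes {1..n}" by simp
  moreover have "transpose 1 k permutes {1..n}"
    by (rule permutes_swap_id) (use k mn in auto)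
  then have "fst (phi m k (\<sigma>, \<alpha>)) permutes {1..n}"
    using s by (auto intro: permutes_compose)
  ultimately show ?thesis by simp
qed

lemma kappa_le_kappa_phi:
  assumes H: "collection_of_hypermaps n (\<sigma>, \<alpha>)" and cyc: "has_cycle \<alpha> [1..<Suc m]"
    and k: "k \<in> {1..m}" and m: "m \<ge> 2"
  shows "kappa n (\<sigma>, \<alpha>) \<le> kappa n (phi m k (\<sigma>, \<alpha>))"
proof -
  let ?E = "graph_of \<sigma> \<union> graph_of \<alpha>"
  obtain s' a' where p: "phi m k (\<sigma>, \<alpha>) = (s', a')" by fastforce
  have perms: "\<sigma> permutes {1..n}" "\<alpha> permutes {1..n}" "s' permutes {1..n}" "a' permutes {1..n}"
    using H collection_of_hypermaps_phi[OF assms] unfolding p by simp_all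
  have s_edge: "(x, \<sigma> x) \<in> conn ?E" and a_edge: "(x, \<alpha> x) \<in> conn ?E" for x
    by (auto intro!: conn_edge simp: graph_of_def)
  have \<alpha>c: "map \<alpha> [1..<Suc m] = rotate1 [1..<Suc m]"
  proof -
    have "map (cycle_of_list [1..<Suc m] ^^ 1) [1..<Suc m] = rotate 1 [1..<Suc m]"
      by (rule cyclic_rotation) simp
    moreover have "map \<alpha> [1..<Suc m] = map (cycle_of_list [1..<Suc m]) [1..<Suc m]"
      using cyc unfolding has_cycle_def by (auto simp del: upt_Suc)
    ultimately show ?thesis by (simp del: upt_Suc)
  qed
  have next_pt: "\<alpha> i = Suc i" if "1 \<le> i" "i < m" for i
  proof -
    have "map \<alpha> [1..<Suc m] ! (i - 1) = rotate1 [1..<Suc m] ! (i - 1)" using \<alpha>c by simp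
    then show ?thesis using that by (simp add: nth_rotate1 del: upt_Suc)
  qed
  have one: "(1, i) \<in> conn ?E" if "1 \<le> i" "i \<le> m" for i
    using that
  proof (induction i rule: dec_induct)
    case base
    show ?case by simp
  next
    case (step i)
    then have "(1, i) \<in> conn ?E" "(i, Suc i) \<in> conn ?E"
      using a_edge[of i] next_pt[of i] by auto
    then show ?case by (rule conn_trans)
  qed
  then have blk: "(i, j) \<in> conn ?E" if "i \<in> {1..m}" "j \<in> {1..m}" for i j
    using that conn_sym conn_trans by (meson atLeastAtMost_iff)
  have sub: "cycle_of_list [i..<j] x \<in> {1..m}" if "1 \<le> i" "j \<le> Suc m" "x \<in> {1..m}" for i j x
  proof -
    have "cycle_of_list [i..<j] permutes {1..m}"
      by (rule permutes_subset[OF cycle_permutes]) (use that in auto)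
    then show ?thesis using that(3) permutes_in_image by metis
  qed
  show ?thesis
    unfolding p
  proof (rule kappa_mono[OF perms])
    show "(x, s' x) \<in> conn ?E" for x
    proof -
      have "(\<sigma> x, transpose 1 k (\<sigma> x)) \<in> conn ?E"
        using blk[of 1 k] blk[of k 1] k by (auto simp: transpose_def)
      then show ?thesis using p s_edge[of x] conn_trans by (fastforce split: if_splits)
    qed
    show "(x, a' x) \<in> conn ?E" for x
    proof (cases "x \<in> {1..m}")
      case True
      have "a' x \<in> {1..m}"
      proof (cases "k \<in> {1, 2}")
        case True
        then have "a' x = cycle_of_list [2..<Suc m] x"
          using p \<open>x \<in> {1..m}\<close> by (auto simp del: upt_Suc)
        then show ?thesis using sub[of 2 "Suc m" x] \<open>x \<in> {1..m}\<close> by simp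
      next
        case False
        then have "a' x = cycle_of_list [2..<k] (cycle_of_list [k..<Suc m] x)"
          using p \<open>x \<in> {1..m}\<close> by (auto simp del: upt_Suc)
        then show ?thesis
          using sub[of 2 k] sub[of k "Suc m" x] \<open>x \<in> {1..m}\<close> k by simp
      qed
      then show ?thesis using True blk by blast
    next
      case False
      then have "a' x = \<alpha> x" using p by auto
      then show ?thesis using a_edge by simp
    qed
  qed
qed

end

theory Submission
  imports Defs
begin

text \<open>Write \<open>z\<close> for the number of cycles. By the genus inequality, \<open>\<beta> \<le> \<alpha>\<close> holds iff
  \<open>z(\<beta>) + z(\<beta>\<inverse>\<alpha>) = |S| + z(\<alpha>)\<close>. The refinements of \<open>\<alpha>\<close> are sorted by the value
  \<open>k = \<beta>(1)\<close>, which lies in \<open>{1..m}\<close>. For fixed \<open>k\<close> the map \<open>\<beta> \<mapsto> (1,k)\<beta>\<close> is a bijection onto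
  the refinements of \<open>\<alpha>\<^sub>k\<close>: here \<open>\<alpha>\<^sub>k\<close> is \<open>(1,2)(1,k)\<alpha>\<close> for \<open>k \<ge> 3\<close> and \<open>(1,2)\<alpha>\<close> for
  \<open>k \<le> 2\<close>, and multiplying by a transposition changes \<open>z\<close> by one, so the equation above is
  preserved. Since \<open>(1,k)\<close> connects \<open>1\<close> and \<open>k\<close> either in \<open>\<beta>\<close> or in \<open>\<sigma>\<^sub>k\<close>, the number of
  components of \<open>(\<sigma>, \<beta>)\<close> is that of \<open>(\<sigma>\<^sub>k, (1,k)\<beta>)\<close>, and the exponents differ exactly by
  those of \<open>w\<^sub>k\<close>.\<close>

section \<open>Connectivity\<close>

lemma conn_mono: "E \<subseteq> E' \<Longrightarrow> conn E \<subseteq> conn E'"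
  by (rule conn_least) (auto intro: conn_edge)

lemma conn_eqI: "E \<subseteq> conn E' \<Longrightarrow> E' \<subseteq> conn E \<Longrightarrow> conn E = conn E'"
  by (intro equalityI conn_least)

lemma conn_Un_cong:
  assumes "conn E = conn E'"
  shows "conn (E \<union> F) = conn (E' \<union> F)"
proof (rule conn_eqI)
  have "E \<subseteq> conn E'" "E' \<subseteq> conn E"
    using assms conn_edge by blast+
  moreover have "conn E' \<subseteq> conn (E' \<union> F)" "conn E \<subseteq> conn (E \<union> F)"
    by (auto intro!: conn_mono)
  moreover have "F \<subseteq> conn (E' \<union> F)" "F \<subseteq> conn (E \<union> F)"
    by (auto intro: conn_edge)
  ultimately show "E \<union> F \<subseteq> conn (E' \<union> F)" "E' \<union> F \<subseteq> conn (E \<union> F)"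
    by blast+
qed

lemma conn_insert_absorb: "(a, b) \<in> conn E \<Longrightarrow> conn (insert (a, b) E) = conn E"
  by (rule conn_eqI) (auto intro: conn_edge)

lemma comps_conn_cong: "conn E = conn E' \<Longrightarrow> comps S E = comps S E'"
  by (simp add: comps_def)

lemma conn_graph_of: "(x, p x) \<in> conn (graph_of p)"
  by (rule conn_edge) (auto simp: graph_of_def)

text \<open>Sending each class to the larger class containing it is onto the new components but
  identifies those of \<open>a\<close> and \<open>b\<close>, so the count drops. With
  \<open>card_comps_insert\<close> the drop is exactly one.\<close>

lemma card_comps_insert_less:
  assumes S: "finite S" "a \<in> S" "b \<in> S" and ab: "(a, b) \<notin> conn E"
  shows "card (comps S (insert (a, b) E)) < card (comps S E)"
proof -
  let ?E = "insert (a, b) E"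
  let ?f = "\<lambda>c. conn ?E `` c"
  have mono: "conn E \<subseteq> conn ?E" by (rule conn_mono) auto
  have eq: "?f (conn E `` {x}) = conn ?E `` {x}" for x
    using mono conn_trans[of _ _ ?E] by fastforce
  have im: "comps S ?E = ?f ` comps S E"
    unfolding comps_def by (simp add: image_image eq)
  have fin: "finite (comps S E)" using S by (simp add: comps_def)
  have "(a, b) \<in> conn ?E" by (rule conn_edge) simp
  then have "?f (conn E `` {a}) = ?f (conn E `` {b})"
    unfolding eq by (rule conn_class_eq)
  moreover have "conn E `` {a} \<noteq> conn E `` {b}"
    using ab by (metis Image_singleton_iff conn_refl)
  moreover have "conn E `` {a} \<in> comps S E" "conn E `` {b} \<in> comps S E"
    using S by (auto simp: comps_def)
  ultimately have "\<not> inj_on ?f (comps S E)"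
    by (meson inj_onD)
  then have "card (?f ` comps S E) \<noteq> card (comps S E)"
    using fin eq_card_imp_inj_on by blast
  then show ?thesis
    unfolding im using card_image_le[OF fin, of ?f] by linarith
qed

section \<open>Multiplication by a transposition\<close>

lemma transpose_comp_cancel: "transpose a b \<circ> (transpose a b \<circ> p) = p"
  by (simp flip: comp_assoc)

text \<open>A step of the product is a step of \<open>p\<close> followed by staying put or crossing
  the edge (a,b). Since the transposition is an involution, the inclusion can be used in both
  directions.\<close>

lemma graph_of_transpose_subset:
  "graph_of (transpose a b \<circ> p) \<subseteq> conn (insert (a, b) (graph_of p))"
proof -
  let ?E = "insert (a, b) (graph_of p)"
  have ab: "(a, b) \<in> conn ?E" by (rule conn_edge) simp
  have "(x, p x) \<in> conn ?E" for x
    by (rule conn_edge) (auto simp: graph_of_def)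
  moreover have "(y, transpose a b y) \<in> conn ?E" for y
    using ab conn_sym[OF ab] by (auto simp: transpose_def)
  ultimately have "(x, transpose a b (p x)) \<in> conn ?E" for x
    using conn_trans by fast
  then show ?thesis by (auto simp: graph_of_def)
qed

lemma conn_insert_transpose:
  "conn (insert (a, b) (graph_of (transpose a b \<circ> p))) = conn (insert (a, b) (graph_of p))"
proof (rule conn_eqI)
  show "insert (a, b) (graph_of (transpose a b \<circ> p)) \<subseteq> conn (insert (a, b) (graph_of p))"
    using graph_of_transpose_subset[of a b p] conn_edge[of "(a, b)"] by blast
  show "insert (a, b) (graph_of p) \<subseteq> conn (insert (a, b) (graph_of (transpose a b \<circ> p)))"
    using graph_of_transpose_subset[of a b "transpose a b \<circ> p"] conn_edge[of "(a, b)"]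
    unfolding transpose_comp_cancel by blast
qed

text \<open>The cycle of \<open>b\<close> avoids \<open>a\<close>, so the product follows it from
  \<open>b\<close> up to the preimage of \<open>b\<close>, which it sends to \<open>a\<close>
  instead.\<close>

lemma conn_transpose_merge:
  assumes p: "permutation p" and ab: "(a, b) \<notin> conn (graph_of p)"
  shows "(a, b) \<in> conn (graph_of (transpose a b \<circ> p))"
proof -
  let ?q = "transpose a b \<circ> p"
  let ?Q = "conn (graph_of ?q)"
  have q: "(y, ?q y) \<in> ?Q" for y by (rule conn_graph_of)
  have orb: "Orbits.orbit p b = conn (graph_of p) `` {b}"
    by (rule orbit_eq_conn[OF p])
  have na: "y \<noteq> a" if "y \<in> Orbits.orbit p b" for y
    using that ab conn_sym[of b a] unfolding orb by auto
  \<comment> \<open>The product agrees with \<open>p\<close> at \<open>y\<close> unless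
    \<open>p y\<close> is \<open>b\<close>, and then it jumps to \<open>a\<close>; the second
    disjunct absorbs this case.\<close>
  have reach1: "(y, p y) \<in> ?Q \<or> (y, a) \<in> ?Q" if "p y \<noteq> a" for y
    using q[of y] that by (auto simp: transpose_def split: if_splits)
  have reach: "(b, y) \<in> ?Q \<or> (b, a) \<in> ?Q" if "y \<in> Orbits.orbit p b" for y
    using that
  proof induction
    case base
    show ?case using reach1 na[OF orbit.base] by blast
  next
    case (step y)
    have "p y \<noteq> a" using na orbit.step[OF step.hyps] by blast
    then have "(y, p y) \<in> ?Q \<or> (y, a) \<in> ?Q" by (rule reach1)
    then show ?case
      using step.IH conn_trans[of b y _ "p y"] conn_trans[of b y _ a] by blast
  qed
  obtain y where y: "p y = b" using p by (metis permutation_bijective bij_pointE)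
  have "(y, b) \<in> conn (graph_of p)" using conn_graph_of[of y p] y by simp
  then have "y \<in> Orbits.orbit p b" unfolding orb using conn_sym[of y b] by simp
  then have "(b, y) \<in> ?Q \<or> (b, a) \<in> ?Q" by (rule reach)
  moreover have "(y, a) \<in> ?Q" using q[of y] y by simp
  ultimately have "(b, a) \<in> ?Q" using conn_trans[of b y _ a] by blast
  then show ?thesis by (rule conn_sym)
qed

text \<open>The stretch of the cycle from \<open>b\<close> up to just before \<open>a\<close>
  becomes closed under the product: its last point, formerly sent to \<open>a\<close>, now returns
  to \<open>b\<close>.\<close>

lemma conn_transpose_split:
  assumes p: "permutation p" and ab: "(a, b) \<in> conn (graph_of p)" "a \<noteq> b"
  shows "(a, b) \<notin> conn (graph_of (transpose a b \<circ> p))"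
proof -
  let ?q = "transpose a b \<circ> p"
  have q: "permutation ?q"
    using p by (intro permutation_compose permutation_swap_id)
  have "a \<in> Orbits.orbit p b"
    unfolding orbit_eq_conn[OF p] using conn_sym[OF ab(1)] by blast
  then have ex: "\<exists>d. (p ^^ d) b = a"
    by (auto simp: orbit_altdef)
  \<comment> \<open>Minimality of \<open>d\<close> keeps \<open>a\<close> out of the stretch
    \<open>A\<close> below.\<close>
  define d where "d = (LEAST d. (p ^^ d) b = a)"
  have d: "(p ^^ d) b = a" unfolding d_def using ex by (rule LeastI_ex)
  have min: "(p ^^ i) b \<noteq> a" if "i < d" for i
    using that not_less_Least unfolding d_def by blast
  define A where "A = (\<lambda>i. (p ^^ i) b) ` {..<d}"
  have "d \<noteq> 0" using d ab(2) by (auto intro: ccontr)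
  then have bA: "b \<in> A" unfolding A_def by (intro image_eqI[of _ _ 0]) auto
  have closed: "?q y \<in> A" if yA: "y \<in> A" for y
  proof -
    obtain i where i: "y = (p ^^ i) b" "i < d" using yA by (auto simp: A_def)
    have py: "p y = (p ^^ Suc i) b" using i by simp
    show ?thesis
    proof (cases "Suc i = d")
      case True
      then show ?thesis using py d bA by simp
    next
      case False
      then have lt: "Suc i < d" using i by simp
      \<comment> \<open>An early return to \<open>b\<close> would make \<open>Suc i\<close> a
        period, so \<open>a\<close> would already be reached after \<open>d - Suc i\<close>
        steps.\<close>
      have "p y \<noteq> b"
      proof
        assume "p y = b"
        then have per: "(p ^^ Suc i) b = b" using py by simp
        have "a = (p ^^ (d - Suc i + Suc i)) b" using d lt by simp
        also have "\<dots> = (p ^^ (d - Suc i)) b" by (subst funpow_add) (simp only: per comp_apply)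
        finally show False using min[of "d - Suc i"] lt by simp
      qed
      moreover have "p y \<noteq> a" unfolding py using min lt by blast
      moreover have "p y \<in> A" unfolding py A_def using lt by blast
      ultimately show ?thesis by simp
    qed
  qed
  have "y \<in> A" if "y \<in> Orbits.orbit ?q b" for y
    using that by induction (use bA closed in auto)
  moreover have "a \<notin> A" using min by (auto simp: A_def)
  ultimately have "(b, a) \<notin> conn (graph_of ?q)"
    unfolding orbit_eq_conn[OF q] by blast
  then show ?thesis using conn_sym[of a b] by blast
qed

lemma conn_graph_of_transpose:
  assumes "permutation p" "(a, b) \<notin> conn (graph_of p)"
  shows "conn (graph_of (transpose a b \<circ> p)) = conn (insert (a, b) (graph_of p))"
  using conn_insert_absorb[OF conn_transpose_merge[OF assms]]
  by (simp add: conn_insert_transpose)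

section \<open>Cycle counts under multiplication by a transposition\<close>

lemma permutes_permutation: "finite S \<Longrightarrow> p permutes S \<Longrightarrow> permutation p"
  by (auto simp: permutation_permutes)

lemma num_cycles_eq_comps: "permutation p \<Longrightarrow> num_cycles S p = card (comps S (graph_of p))"
  by (simp add: num_cycles_def cycle_sets_eq_comps)

lemma num_cycles_transpose_merge:
  assumes S: "finite S" "p permutes S" "a \<in> S" "b \<in> S"
    and ab: "(a, b) \<notin> conn (graph_of p)"
  shows "num_cycles S p = num_cycles S (transpose a b \<circ> p) + 1"
proof -
  have p: "permutation p" using S permutes_permutation by blast
  then have q: "permutation (transpose a b \<circ> p)"
    by (intro permutation_compose permutation_swap_id)
  show ?thesis
    unfolding num_cycles_eq_comps[OF p] num_cycles_eq_comps[OF q]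
      comps_conn_cong[OF conn_graph_of_transpose[OF p ab]]
    using card_comps_insert[OF S(1,3), of "graph_of p" b]
      card_comps_insert_less[OF S(1,3,4) ab] by linarith
qed

text \<open>This is the merging case read backwards: multiplying the product by the same
  transposition gives \<open>p\<close> back.\<close>

lemma num_cycles_transpose_split:
  assumes S: "finite S" "p permutes S" "a \<in> S" "b \<in> S"
    and ab: "(a, b) \<in> conn (graph_of p)" "a \<noteq> b"
  shows "num_cycles S (transpose a b \<circ> p) = num_cycles S p + 1"
proof -
  have "permutation p" using S permutes_permutation by blast
  then have "(a, b) \<notin> conn (graph_of (transpose a b \<circ> p))"
    using ab by (rule conn_transpose_split)
  moreover have "transpose a b \<circ> p permutes S"
    using S by (intro permutes_compose permutes_swap_id)
  ultimately show ?thesis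
    using num_cycles_transpose_merge[of S "transpose a b \<circ> p" a b] S
    by (simp add: transpose_comp_cancel)
qed

text \<open>A point and its image share a cycle, so this is always the splitting case; the product
  fixes \<open>a\<close>.\<close>

lemma num_cycles_transpose_image:
  assumes "finite S" "p permutes S" "a \<in> S" "p a \<noteq> a"
  shows "num_cycles S (transpose a (p a) \<circ> p) = num_cycles S p + 1"
  using assms permutes_in_image[OF assms(2)] conn_graph_of[of a p]
  by (intro num_cycles_transpose_split) auto

section \<open>The genus inequality\<close>

lemma conn_graph_of_id: "conn (graph_of id) = Id"
proof -
  have "graph_of id \<union> (graph_of id)\<inverse> = Id" by (auto simp: graph_of_def)
  then show ?thesis by (metis conn_def rtrancl_empty rtrancl_reflcl sup_bot_left)
qed

lemma num_cycles_id: "num_cycles S id = card S"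
proof -
  have "comps S (graph_of id) = (\<lambda>x. {x}) ` S"
    unfolding comps_def conn_graph_of_id by auto
  then show ?thesis
    by (simp add: num_cycles_eq_comps[OF permutation_id] card_image)
qed

text \<open>Peeling a transposition off \<open>\<beta>\<close> and moving it over to \<open>\<alpha>\<close> leaves \<open>\<beta>\<inverse>\<alpha>\<close> unchanged.\<close>

lemma genus_nonneg:
  assumes S: "finite S" and "\<alpha> permutes S" and "\<beta> permutes S"
  shows "num_cycles S \<beta> + num_cycles S (inv' \<beta> \<circ> \<alpha>) + num_cycles S \<alpha>
    \<le> card S + 2 * card (comps S (graph_of \<alpha> \<union> graph_of \<beta>))"
  using assms(2,3)
\<comment> \<open>The measure is the number of points moved by \<beta>: peeling makes
  \<open>x\<close> fixed and moves no new point.\<close>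
proof (induction "card {x. \<beta> x \<noteq> x}" arbitrary: \<alpha> \<beta> rule: less_induct)
  case less
  note \<alpha> = less.prems(1) and \<beta> = less.prems(2)
  have perm: "permutation \<alpha>" "permutation \<beta>"
    using \<alpha> \<beta> S permutes_permutation by blast+
  show ?case
  proof (cases "\<beta> = id")
    case True
    have "conn (graph_of \<alpha> \<union> graph_of id) = conn (graph_of \<alpha>)"
      by (rule conn_eqI) (auto simp: graph_of_def intro: conn_edge)
    then have "comps S (graph_of \<alpha> \<union> graph_of \<beta>) = comps S (graph_of \<alpha>)"
      using True by (intro comps_conn_cong) simp
    then show ?thesis
      using True by (simp add: num_cycles_id num_cycles_eq_comps[OF perm(1)])
  next
    case False
    then obtain x where x: "\<beta> x \<noteq> x" by (auto simp: fun_eq_iff)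
    define b where "b = \<beta> x"
    have xb: "x \<noteq> b" using x b_def by auto
    have xS: "x \<in> S" using x \<beta> by (metis permutes_not_in)
    then have bS: "b \<in> S" unfolding b_def using \<beta> by (simp add: permutes_in_image)
    define \<gamma> where "\<gamma> = transpose x b \<circ> \<beta>"
    define \<alpha>' where "\<alpha>' = transpose x b \<circ> \<alpha>"
    have \<gamma>: "\<gamma> permutes S" and \<alpha>': "\<alpha>' permutes S"
      unfolding \<gamma>_def \<alpha>'_def using \<alpha> \<beta> xS bS by (auto intro: permutes_compose permutes_swap_id)
    have "\<gamma> x = x" by (simp add: \<gamma>_def b_def)
    moreover have "\<gamma> y = y" if "\<beta> y = y" for y
    proof -
      have "y \<noteq> b" using that x \<beta> by (metis b_def permutes_inj injD)
      then show ?thesis using that x by (auto simp: \<gamma>_def transpose_def)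
    qed
    ultimately have "{y. \<gamma> y \<noteq> y} \<subset> {y. \<beta> y \<noteq> y}" using x by blast
    moreover have "finite {y. \<beta> y \<noteq> y}"
      by (rule finite_subset[OF _ S]) (use \<beta> permutes_not_in in fastforce)
    ultimately have "card {y. \<gamma> y \<noteq> y} < card {y. \<beta> y \<noteq> y}"
      by (intro psubset_card_mono)
    note IH = less.hyps[OF this \<alpha>' \<gamma>]
    have inv: "inv' \<gamma> \<circ> \<alpha>' = inv' \<beta> \<circ> \<alpha>"
    proof -
      have "inv' \<gamma> = inv' \<beta> \<circ> transpose x b"
        unfolding \<gamma>_def using \<beta> by (subst o_inv_distrib) (auto intro: permutes_bij)
      then show ?thesis
        by (simp add: \<alpha>'_def comp_assoc transpose_comp_cancel)
    qed
    have z\<gamma>: "num_cycles S \<gamma> = num_cycles S \<beta> + 1"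
      unfolding \<gamma>_def b_def using S \<beta> xS x by (rule num_cycles_transpose_image)
    let ?E = "graph_of \<alpha> \<union> graph_of \<beta>"
    let ?E' = "graph_of \<alpha>' \<union> graph_of \<gamma>"
    \<comment> \<open>One extra edge makes up for both transpositions, so peeling creates at most
      one new component.\<close>
    have sub: "?E \<subseteq> conn (insert (x, b) ?E')"
    proof -
      have "\<alpha> = transpose x b \<circ> \<alpha>'" "\<beta> = transpose x b \<circ> \<gamma>"
        by (simp_all add: \<alpha>'_def \<gamma>_def transpose_comp_cancel)
      then have "graph_of \<alpha> \<subseteq> conn (insert (x, b) (graph_of \<alpha>'))"
        "graph_of \<beta> \<subseteq> conn (insert (x, b) (graph_of \<gamma>))"
        using graph_of_transpose_subset by metis+
      moreover have "conn (insert (x, b) (graph_of \<alpha>')) \<subseteq> conn (insert (x, b) ?E')"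
        "conn (insert (x, b) (graph_of \<gamma>)) \<subseteq> conn (insert (x, b) ?E')"
        by (rule conn_mono; blast)+
      ultimately show ?thesis by blast
    qed
    show ?thesis
    proof (cases "(x, b) \<in> conn (graph_of \<alpha>)")
      \<comment> \<open>Both \<alpha> and \<beta> gain a cycle, so the left side grows by two; the
        components may grow by one, and they count twice.\<close>
      case True
      then have "num_cycles S \<alpha>' = num_cycles S \<alpha> + 1"
        unfolding \<alpha>'_def using S \<alpha> xS bS xb by (intro num_cycles_transpose_split)
      moreover have "card (comps S ?E') \<le> card (comps S ?E) + 1"
        using card_comps_insert[OF S xS, of ?E' b] card_comps_antimono[OF S sub] by linarith
      ultimately show ?thesis using IH inv z\<gamma> by simp
    next
      \<comment> \<open>The cycle gained by \<beta> is lost by \<alpha>, so no new component is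
        affordable; indeed \<open>\<alpha>'\<close> itself connects \<open>x\<close> and
        \<open>b\<close>.\<close>
      case False
      then have "num_cycles S \<alpha> = num_cycles S \<alpha>' + 1"
        unfolding \<alpha>'_def using S \<alpha> xS bS by (intro num_cycles_transpose_merge)
      moreover have "card (comps S ?E') \<le> card (comps S ?E)"
      proof -
        have "(x, b) \<in> conn (graph_of \<alpha>')"
          unfolding \<alpha>'_def using perm(1) False by (rule conn_transpose_merge)
        then have "(x, b) \<in> conn ?E'" using conn_mono[of "graph_of \<alpha>'" ?E'] by blast
        then show ?thesis
          using card_comps_antimono[OF S sub] comps_conn_cong[OF conn_insert_absorb] by metis
      qed
      ultimately show ?thesis using IH inv z\<gamma> by simp
    qed
  qed
qed

section \<open>Refinements and the genus\<close>

lemma perm_restrict_permutes: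
  assumes p: "p permutes S" and C: "finite C" and inv: "\<And>x. x \<in> C \<Longrightarrow> p x \<in> C"
  shows "perm_restrict p C permutes C"
proof (rule bij_imp_permutes)
  have inj: "inj_on (perm_restrict p C) C"
    using permutes_inj[OF p] by (auto simp: inj_on_def perm_restrict_def dest: injD)
  moreover have "perm_restrict p C ` C \<subseteq> C"
    using inv by (auto simp: perm_restrict_def)
  ultimately show "bij_betw (perm_restrict p C) C C"
    using C by (simp add: bij_betw_def endo_inj_surj)
qed (simp add: perm_restrict_def)

lemma orbit_perm_restrict:
  assumes inv: "\<And>x. x \<in> C \<Longrightarrow> p x \<in> C" and x: "x \<in> C"
  shows "Orbits.orbit (perm_restrict p C) x = Orbits.orbit p x"
proof -
  have "(perm_restrict p C ^^ i) x = (p ^^ i) x \<and> (p ^^ i) x \<in> C" for i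
    by (induction i) (auto simp: perm_restrict_def x inv)
  then show ?thesis by (simp add: orbit_altdef)
qed

text \<open>Every cycle is nonempty and stays inside one block, so distinct blocks contribute
  disjoint families of cycles.\<close>

lemma num_cycles_partition:
  assumes S: "finite S" and P: "\<Union>P = S" "pairwise disjnt P"
    and inv: "\<And>C x. C \<in> P \<Longrightarrow> x \<in> C \<Longrightarrow> p x \<in> C"
  shows "num_cycles S p = (\<Sum>C\<in>P. num_cycles C (perm_restrict p C))"
proof -
  have finP: "finite P" using S P(1) by (metis finite_UnionD)
  have finC: "finite C" if "C \<in> P" for C
    using S P(1) that by (metis Union_upper finite_subset)
  have cyc: "cycle_sets C (perm_restrict p C) = {Orbits.orbit p x | x. x \<in> C}" if "C \<in> P" for C
    using orbit_perm_restrict[of C p] inv that unfolding cycle_sets_def by (metis (no_types, lifting))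
  have orb: "Orbits.orbit p x \<subseteq> C" if "C \<in> P" "x \<in> C" for C x
  proof
    fix y assume "y \<in> Orbits.orbit p x"
    then show "y \<in> C" by induction (use inv that in auto)
  qed
  have "cycle_sets S p = (\<Union>C\<in>P. cycle_sets C (perm_restrict p C))"
    using P(1) cyc by (auto simp: cycle_sets_def)
  moreover have "card \<dots> = (\<Sum>C\<in>P. card (cycle_sets C (perm_restrict p C)))"
  proof (rule card_UN_disjoint[OF finP])
    show "\<forall>C\<in>P. finite (cycle_sets C (perm_restrict p C))"
      using cyc finC by simp
    show "\<forall>C\<in>P. \<forall>D\<in>P. C \<noteq> D \<longrightarrow>
        cycle_sets C (perm_restrict p C) \<inter> cycle_sets D (perm_restrict p D) = {}"
    proof (intro ballI impI)
      fix C D assume CD: "C \<in> P" "D \<in> P" "C \<noteq> D"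
      have "C \<inter> D = {}" using P(2) CD by (auto simp: pairwise_def disjnt_def)
      moreover have "c \<noteq> {} \<and> c \<subseteq> E" if "E \<in> P" "c \<in> cycle_sets E (perm_restrict p E)" for c E
        using that orb by (auto simp: cyc orbit_nonempty)
      ultimately show "cycle_sets C (perm_restrict p C) \<inter> cycle_sets D (perm_restrict p D) = {}"
        using CD by blast
    qed
  qed
  ultimately show ?thesis by (simp add: num_cycles_def)
qed

text \<open>This turns the blockwise quotient in \<open>refines\<close> into a restriction of the
  global one, to which \<open>num_cycles_partition\<close> applies.\<close>

lemma inv_perm_restrict_comp:
  assumes p: "p permutes S" and pC: "perm_restrict p C permutes C"
    and q: "\<And>x. x \<in> C \<Longrightarrow> q x \<in> C"
  shows "inv' (perm_restrict p C) \<circ> perm_restrict q C = perm_restrict (inv' p \<circ> q) C"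
proof
  fix x
  show "(inv' (perm_restrict p C) \<circ> perm_restrict q C) x = perm_restrict (inv' p \<circ> q) C x"
  proof (cases "x \<in> C")
    case True
    then obtain y where y: "y \<in> C" "perm_restrict p C y = q x"
      using q permutes_image[OF pC] by (metis imageE)
    then have "p y = q x" by (simp add: perm_restrict_def)
    then have "inv' p (q x) = y" using permutes_inj[OF p] by (metis inv_f_eq)
    moreover have "inv' (perm_restrict p C) (q x) = y"
      using permutes_inj[OF pC] y(2) by (metis inv_f_eq)
    ultimately show ?thesis using True by (simp add: perm_restrict_def)
  next
    case False
    then show ?thesis
      using permutes_not_in[OF permutes_inv[OF pC]] by (simp add: perm_restrict_def)
  qed
qed

lemma Union_cycle_sets:
  assumes "finite S" "p permutes S"
  shows "\<Union>(cycle_sets S p) = S"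
proof -
  have "permutation p" using assms by (rule permutes_permutation)
  then show ?thesis
    using permutes_orbit_subset[OF assms(2)] permutation_self_in_orbit
    by (fastforce simp: cycle_sets_def)
qed

lemma orbit_eq_of_mem:
  assumes "permutation p" "y \<in> Orbits.orbit p x"
  shows "Orbits.orbit p y = Orbits.orbit p x"
  using assms conn_class_eq[of x y "graph_of p"] by (simp add: orbit_eq_conn)

lemma pairwise_disjnt_cycle_sets:
  assumes "permutation p"
  shows "pairwise disjnt (cycle_sets S p)"
  unfolding pairwise_def disjnt_def cycle_sets_def
  using orbit_eq_of_mem[OF assms] by blast

lemma cycle_sets_eq_orbit:
  assumes "permutation p" "C \<in> cycle_sets S p" "x \<in> C"
  shows "C = Orbits.orbit p x"
  using assms(2,3) orbit_eq_of_mem[OF assms(1)] by (auto simp: cycle_sets_def)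

lemma refines_in_orbit:
  assumes \<alpha>: "permutation \<alpha>" and "refines S \<beta> \<alpha>" "x \<in> S"
  shows "\<beta> x \<in> Orbits.orbit \<alpha> x"
proof -
  have "Orbits.orbit \<alpha> x \<in> cycle_sets S \<alpha>" using assms by (auto simp: cycle_sets_def)
  then have "perm_restrict \<beta> (Orbits.orbit \<alpha> x) permutes Orbits.orbit \<alpha> x"
    using assms by (simp add: refines_def)
  then show ?thesis
    using permutation_self_in_orbit[OF \<alpha>] by (metis permutes_in_image perm_restrict_simps(1))
qed

text \<open>Both directions rest on the genus inequality: applied to all of \<open>S\<close> it forces \<open>\<beta>\<close> to preserve
  the cycles of \<open>\<alpha>\<close>, and applied to each cycle of \<open>\<alpha>\<close> it makes a sum of inequalities tight only
  if each of them is.\<close>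

lemma refines_iff_num_cycles:
  assumes S: "finite S" and \<alpha>: "\<alpha> permutes S"
  shows "refines S \<beta> \<alpha> \<longleftrightarrow> \<beta> permutes S \<and>
    num_cycles S \<beta> + num_cycles S (inv' \<beta> \<circ> \<alpha>) = card S + num_cycles S \<alpha>"
proof -
  let ?P = "cycle_sets S \<alpha>"
  let ?z = "\<lambda>C. num_cycles C (perm_restrict \<beta> C)
    + num_cycles C (inv' (perm_restrict \<beta> C) \<circ> perm_restrict \<alpha> C)"
  have p\<alpha>: "permutation \<alpha>" using S \<alpha> by (rule permutes_permutation)
  have U: "\<Union>?P = S" using S \<alpha> by (rule Union_cycle_sets)
  have D: "pairwise disjnt ?P" using p\<alpha> by (rule pairwise_disjnt_cycle_sets)
  have finP: "finite ?P" using S U by (metis finite_UnionD)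
  have finC: "finite C" if "C \<in> ?P" for C
    using S U that by (metis Union_upper finite_subset)
  have C\<alpha>: "\<alpha> x \<in> C" if "C \<in> ?P" "x \<in> C" for C x
    using cycle_sets_eq_orbit[OF p\<alpha> that] orbit.base[of \<alpha> x] by simp
  \<comment> \<open>When \<beta> preserves the cycles of \<alpha>, the global equation is the sum of
    the genus equations over these cycles.\<close>
  have core: "refines S \<beta> \<alpha> \<longleftrightarrow>
      num_cycles S \<beta> + num_cycles S (inv' \<beta> \<circ> \<alpha>) = card S + num_cycles S \<alpha>"
    if \<beta>: "\<beta> permutes S" and C\<beta>: "\<And>C x. C \<in> ?P \<Longrightarrow> x \<in> C \<Longrightarrow> \<beta> x \<in> C"
  proof -
    have \<beta>C: "perm_restrict \<beta> C permutes C" if "C \<in> ?P" for C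
      using \<beta> finC[OF that] C\<beta>[OF that] by (rule perm_restrict_permutes)
    have \<alpha>C: "perm_restrict \<alpha> C permutes C" if "C \<in> ?P" for C
      using \<alpha> finC[OF that] C\<alpha>[OF that] by (rule perm_restrict_permutes)
    have inv: "inv' (perm_restrict \<beta> C) \<circ> perm_restrict \<alpha> C = perm_restrict (inv' \<beta> \<circ> \<alpha>) C"
      if "C \<in> ?P" for C
      using \<beta> \<beta>C[OF that] C\<alpha>[OF that] by (rule inv_perm_restrict_comp)
    have "(inv' \<beta> \<circ> \<alpha>) x \<in> C" if C: "C \<in> ?P" "x \<in> C" for C x
    proof -
      have "(inv' (perm_restrict \<beta> C) \<circ> perm_restrict \<alpha> C) x \<in> C"
        using permutes_compose[OF \<alpha>C permutes_inv[OF \<beta>C]] C by (metis permutes_in_image)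
      then show ?thesis using inv[OF C(1)] C(2) by (simp add: perm_restrict_def)
    qed
    then have sum: "num_cycles S \<beta> + num_cycles S (inv' \<beta> \<circ> \<alpha>) = sum ?z ?P"
      using num_cycles_partition[OF S U D, of \<beta>] C\<beta>
        num_cycles_partition[OF S U D, of "inv' \<beta> \<circ> \<alpha>"] inv
      by (simp add: sum.distrib)
    have "card S = sum card ?P"
      using card_Union_disjoint[OF D finC] U by simp
    then have card: "card S + num_cycles S \<alpha> = (\<Sum>C\<in>?P. card C + 1)"
      by (simp add: sum_Suc num_cycles_def)
    \<comment> \<open>On \<open>C\<close> the restriction of \<alpha> is a single cycle, so there is
      one component and the genus inequality reads as claimed.\<close>
    have le: "?z C \<le> card C + 1" if C: "C \<in> ?P" for C
    proof -
      have "cycle_sets C (perm_restrict \<alpha> C) = {C}"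
      proof -
        have "Orbits.orbit (perm_restrict \<alpha> C) x = C" if "x \<in> C" for x
          using orbit_perm_restrict[of C \<alpha> x] C\<alpha>[OF C] that cycle_sets_eq_orbit[OF p\<alpha> C that] by simp
        moreover have "C \<noteq> {}" using C by (auto simp: cycle_sets_def orbit_nonempty)
        ultimately show ?thesis by (auto simp: cycle_sets_def)
      qed
      then have one: "num_cycles C (perm_restrict \<alpha> C) = 1" by (simp add: num_cycles_def)
      have "card (comps C (graph_of (perm_restrict \<alpha> C) \<union> graph_of (perm_restrict \<beta> C)))
          \<le> card (comps C (graph_of (perm_restrict \<alpha> C)))"
        by (rule card_comps_antimono[OF finC[OF C]]) (auto intro: conn_edge)
      also have "\<dots> = 1"
        using one num_cycles_eq_comps permutes_permutation[OF finC[OF C] \<alpha>C[OF C]] by metis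
      finally show ?thesis
        using genus_nonneg[OF finC[OF C] \<alpha>C[OF C] \<beta>C[OF C]] one by linarith
    qed
    have "sum ?z ?P = (\<Sum>C\<in>?P. card C + 1) \<longleftrightarrow> (\<forall>C\<in>?P. ?z C = card C + 1)"
      using sum_mono_inv[of ?z ?P "\<lambda>C. card C + 1"] le finP by auto
    then show ?thesis
      unfolding sum card refines_def using \<beta> \<beta>C by blast
  qed
  show ?thesis
  proof
    assume R: "refines S \<beta> \<alpha>"
    then have \<beta>: "\<beta> permutes S" by (simp add: refines_def)
    have "\<beta> x \<in> C" if "C \<in> ?P" "x \<in> C" for C x
      using refines_in_orbit[OF p\<alpha> R, of x] cycle_sets_eq_orbit[OF p\<alpha> that] that U by blast
    then show "\<beta> permutes S \<and>
        num_cycles S \<beta> + num_cycles S (inv' \<beta> \<circ> \<alpha>) = card S + num_cycles S \<alpha>"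
      using core \<beta> R by blast
  next
    assume A: "\<beta> permutes S \<and>
        num_cycles S \<beta> + num_cycles S (inv' \<beta> \<circ> \<alpha>) = card S + num_cycles S \<alpha>"
    let ?E = "graph_of \<alpha> \<union> graph_of \<beta>"
    \<comment> \<open>The assumed equation cancels against the genus inequality and shows that
      \<beta> merges no cycles of \<alpha>.\<close>
    have "2 * num_cycles S \<alpha> \<le> 2 * card (comps S ?E)"
      using genus_nonneg[OF S \<alpha>, of \<beta>] A by linarith
    then have le: "card (comps S (graph_of \<alpha>)) \<le> card (comps S ?E)"
      by (simp add: num_cycles_eq_comps[OF p\<alpha>])
    have "(x, \<beta> x) \<in> conn (graph_of \<alpha>)" if x: "x \<in> S" for x
    proof (rule ccontr)
      assume "(x, \<beta> x) \<notin> conn (graph_of \<alpha>)"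
      moreover have "\<beta> x \<in> S" using A x by (simp add: permutes_in_image)
      ultimately have "card (comps S (insert (x, \<beta> x) (graph_of \<alpha>))) < card (comps S (graph_of \<alpha>))"
        using S x by (intro card_comps_insert_less)
      moreover have "insert (x, \<beta> x) (graph_of \<alpha>) \<subseteq> ?E" by (auto simp: graph_of_def)
      then have "insert (x, \<beta> x) (graph_of \<alpha>) \<subseteq> conn ?E" using conn_edge[of _ ?E] by blast
      then have "card (comps S ?E) \<le> card (comps S (insert (x, \<beta> x) (graph_of \<alpha>)))"
        by (rule card_comps_antimono[OF S])
      ultimately show False using le by linarith
    qed
    then have orb: "\<beta> x \<in> Orbits.orbit \<alpha> x" if "x \<in> S" for x
      using that by (simp add: orbit_eq_conn[OF p\<alpha>])
    have "\<beta> x \<in> C" if "C \<in> ?P" "x \<in> C" for C x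
      using orb[of x] cycle_sets_eq_orbit[OF p\<alpha> that] that U by blast
    then show "refines S \<beta> \<alpha>" using core A by blast
  qed
qed

section \<open>Refinements under multiplication by a transposition\<close>

text \<open>Detaching a fixed point of \<beta> from its cycle in \<alpha> adds one cycle to \<alpha>
  and one to the quotient, so the criterion \<open>refines_iff_num_cycles\<close> stays
  balanced.\<close>

lemma refines_transpose_fixed_point:
  assumes S: "finite S" and \<alpha>: "\<alpha> permutes S" and a: "a \<in> S" "\<alpha> a \<noteq> a"
    and \<beta>: "\<beta> permutes S" "\<beta> a = a"
  shows "refines S \<beta> \<alpha> \<longleftrightarrow> refines S \<beta> (transpose a (\<alpha> a) \<circ> \<alpha>)"
proof -
  let ?\<rho> = "inv' \<beta> \<circ> \<alpha>"
  have \<rho>: "?\<rho> permutes S" using \<alpha> \<beta> by (intro permutes_compose permutes_inv)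
  have inva: "inv' \<beta> a = a" using \<beta> permutes_inv_eq by metis
  have ne: "?\<rho> a \<noteq> a"
  proof
    assume "?\<rho> a = a"
    then have "\<alpha> a = \<beta> a" using \<beta>(1) by (simp add: permutes_inv_eq)
    then show False using a \<beta> by simp
  qed
  \<comment> \<open>Moving the transposition across \<open>inv' \<beta>\<close> conjugates it, and
    \<open>inv' \<beta>\<close> fixes \<open>a\<close>.\<close>
  have "inv' \<beta> \<circ> (transpose a (\<alpha> a) \<circ> \<alpha>) = transpose a (?\<rho> a) \<circ> ?\<rho>"
  proof -
    have "bij (inv' \<beta>)" using \<beta>(1) by (intro permutes_bij permutes_inv)
    then have "inv' \<beta> \<circ> transpose a (\<alpha> a) = transpose (inv' \<beta> a) (inv' \<beta> (\<alpha> a)) \<circ> inv' \<beta>"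
      using transpose_comp_eq[of "inv' \<beta>"]
      by (auto simp: fun_eq_iff transpose_def bij_def inj_eq)
    then show ?thesis unfolding inva by (simp add: comp_assoc[symmetric])
  qed
  then have "num_cycles S (inv' \<beta> \<circ> (transpose a (\<alpha> a) \<circ> \<alpha>)) = num_cycles S ?\<rho> + 1"
    using num_cycles_transpose_image[OF S \<rho> a(1) ne] by metis
  moreover have "num_cycles S (transpose a (\<alpha> a) \<circ> \<alpha>) = num_cycles S \<alpha> + 1"
    using S \<alpha> a by (rule num_cycles_transpose_image)
  moreover have "transpose a (\<alpha> a) \<circ> \<alpha> permutes S"
    using \<alpha> a permutes_in_image[OF \<alpha>] by (intro permutes_compose permutes_swap_id) auto
  ultimately show ?thesis
    using S \<alpha> by (simp add: refines_iff_num_cycles)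
qed

text \<open>The quotient is unchanged, while \<alpha> and \<beta> each gain one cycle, on opposite
  sides of the criterion.\<close>

lemma refines_transpose:
  assumes S: "finite S" and \<alpha>: "\<alpha> permutes S" and a: "a \<in> S" "\<beta> a \<noteq> a"
    and ab: "(a, \<beta> a) \<in> conn (graph_of \<alpha>)" and \<beta>: "\<beta> permutes S"
  shows "refines S \<beta> \<alpha> \<longleftrightarrow> refines S (transpose a (\<beta> a) \<circ> \<beta>) (transpose a (\<beta> a) \<circ> \<alpha>)"
proof -
  let ?t = "transpose a (\<beta> a)"
  have b: "\<beta> a \<in> S" using \<beta> a by (simp add: permutes_in_image)
  have t: "?t permutes S" using a(1) b by (rule permutes_swap_id)
  have "inv' (?t \<circ> \<beta>) = inv' \<beta> \<circ> ?t"
    using \<beta> by (subst o_inv_distrib) (auto intro: permutes_bij)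
  then have "inv' (?t \<circ> \<beta>) \<circ> (?t \<circ> \<alpha>) = inv' \<beta> \<circ> \<alpha>"
    by (simp add: comp_assoc transpose_comp_cancel)
  moreover have "num_cycles S (?t \<circ> \<beta>) = num_cycles S \<beta> + 1"
    using S \<beta> a by (rule num_cycles_transpose_image)
  moreover have "num_cycles S (?t \<circ> \<alpha>) = num_cycles S \<alpha> + 1"
    using S \<alpha> a(1) b ab a(2) by (intro num_cycles_transpose_split) auto
  moreover have "?t \<circ> \<alpha> permutes S" "?t \<circ> \<beta> permutes S"
    using \<alpha> \<beta> t by (auto intro: permutes_compose)
  ultimately show ?thesis
    using S \<alpha> \<beta> by (simp add: refines_iff_num_cycles)
qed

section \<open>The operations \<open>\<phi>\<^sub>k\<close>\<close>

text \<open>Lowering \<open>i\<close> by one multiplies the cycle on the left by a transposition of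
  neighbours, hence the downward induction.\<close>

lemma cycle_of_list_upt:
  assumes "i \<le> j"
  shows "cycle_of_list [i..<Suc j] x = (if x = j then i else if i \<le> x \<and> x < j then Suc x else x)"
  using assms
proof (induction i arbitrary: x rule: inc_induct)
  case base
  show ?case by simp
next
  case (step i)
  have "[i..<Suc j] = i # Suc i # [Suc (Suc i)..<Suc j]"
    using step.hyps by (simp add: upt_conv_Cons del: upt_Suc)
  moreover have "[Suc i..<Suc j] = Suc i # [Suc (Suc i)..<Suc j]"
    using step.hyps by (simp add: upt_conv_Cons del: upt_Suc)
  ultimately have "cycle_of_list [i..<Suc j] x = transpose i (Suc i) (cycle_of_list [Suc i..<Suc j] x)"
    by simp
  then show ?case
    unfolding step.IH using step.hyps by (auto simp: transpose_def)
qed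

section \<open>The distinguished cycle (1, ..., m)\<close>

locale hypermaps_with_cycle =
  fixes n m :: nat and \<sigma> \<alpha> :: "nat \<Rightarrow> nat"
  assumes coll: "collection_of_hypermaps n (\<sigma>, \<alpha>)"
    and two_le_m: "m \<ge> 2"
    and cyc: "has_cycle \<alpha> [1..<Suc m]"
begin

lemma permutes: "\<sigma> permutes {1..n}" "\<alpha> permutes {1..n}"
  using coll by auto

lemma permutation: "permutation \<sigma>" "permutation \<alpha>"
  using permutes permutes_permutation[of "{1..n}"] by auto

lemma \<alpha>_cycle: "x \<in> {1..m} \<Longrightarrow> \<alpha> x = (if x = m then 1 else Suc x)"
  using cyc two_le_m cycle_of_list_upt[of 1 m x] unfolding has_cycle_def
  by (auto simp del: upt_Suc)

lemma \<alpha>_one: "\<alpha> 1 = 2"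
  using \<alpha>_cycle[of 1] two_le_m by simp

lemma \<alpha>_notin: "x \<notin> {1..m} \<Longrightarrow> \<alpha> x \<notin> {1..m}"
proof
  assume x: "x \<notin> {1..m}" and "\<alpha> x \<in> {1..m}"
  \<comment> \<open>The predecessor of \<open>\<alpha> x\<close> on the cycle; injectivity forces it
    to be \<open>x\<close>.\<close>
  define y where "y = (if \<alpha> x = 1 then m else \<alpha> x - 1)"
  have y: "y \<in> {1..m}" using \<open>\<alpha> x \<in> {1..m}\<close> two_le_m by (auto simp: y_def)
  have "(if y = m then 1 else Suc y) = \<alpha> x"
    using \<open>\<alpha> x \<in> {1..m}\<close> by (cases "\<alpha> x") (auto simp: y_def)
  then have "\<alpha> y = \<alpha> x" using \<alpha>_cycle[OF y] by simp
  then have "x = y" using permutes_inj[OF permutes(2)] by (metis injD)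
  then show False using x y by simp
qed

lemma m_le_n: "m \<le> n"
proof (rule ccontr)
  assume "\<not> m \<le> n"
  then have "\<alpha> m = m" using permutes(2) by (simp add: permutes_not_in)
  then show False using \<alpha>_cycle[of m] two_le_m by simp
qed

lemma orbit_\<alpha>_one: "Orbits.orbit \<alpha> 1 = {1..m}"
proof
  show "Orbits.orbit \<alpha> 1 \<subseteq> {1..m}"
  proof
    fix x assume "x \<in> Orbits.orbit \<alpha> 1"
    then show "x \<in> {1..m}"
      by induction (use \<alpha>_cycle two_le_m in \<open>auto split: if_splits\<close>)
  qed
  have "1 \<le> x \<Longrightarrow> x \<le> m \<Longrightarrow> x \<in> Orbits.orbit \<alpha> 1" for x
  proof (induction x rule: dec_induct)
    case base
    show ?case using permutation(2) by (rule permutation_self_in_orbit)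
  next
    case (step x)
    then have "\<alpha> x = Suc x" "x \<in> Orbits.orbit \<alpha> 1" using \<alpha>_cycle[of x] by auto
    then show ?case using orbit.step by metis
  qed
  then show "{1..m} \<subseteq> Orbits.orbit \<alpha> 1" by auto
qed

section \<open>The components of \<open>phi\<close> as products with transpositions\<close>

definition "\<sigma>\<^sub>k k = fst (phi m k (\<sigma>, \<alpha>))"
definition "\<alpha>\<^sub>k k = snd (phi m k (\<sigma>, \<alpha>))"

lemma phi_eq: "phi m k (\<sigma>, \<alpha>) = (\<sigma>\<^sub>k k, \<alpha>\<^sub>k k)"
  by (simp add: \<sigma>\<^sub>k_def \<alpha>\<^sub>k_def)

lemma phi_permutes:
  assumes "k \<in> {1..m}"
  shows "\<sigma>\<^sub>k k permutes {1..n}" "\<alpha>\<^sub>k k permutes {1..n}"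
  using collection_of_hypermaps_phi[OF coll cyc assms two_le_m] unfolding phi_eq by auto

text \<open>For k at least 3, (1,k) splits (1,...,m) into (1,...,k-1)(k,...,m), and (1,2) then
  detaches 1 from the first part. For k at most 2, (1,2) alone detaches 1.\<close>

lemma \<alpha>\<^sub>k_eq:
  assumes k: "k \<in> {1..m}"
  shows "\<alpha>\<^sub>k k = transpose 1 2 \<circ> (if k \<in> {1, 2} then \<alpha> else transpose 1 k \<circ> \<alpha>)"
proof
  fix x
  show "\<alpha>\<^sub>k k x = (transpose 1 2 \<circ> (if k \<in> {1, 2} then \<alpha> else transpose 1 k \<circ> \<alpha>)) x"
  proof (cases "x \<in> {1..m}")
    case False
    then have "\<alpha> x \<notin> {1, 2, k}" using \<alpha>_notin[OF False] k two_le_m by auto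
    then show ?thesis using False by (auto simp: \<alpha>\<^sub>k_def transpose_def simp del: upt_Suc)
  next
    case x: True
    show ?thesis
    proof (cases "k \<in> {1, 2}")
      case True
      then have "\<alpha>\<^sub>k k x = cycle_of_list [2..<Suc m] x"
        using x by (auto simp: \<alpha>\<^sub>k_def simp del: upt_Suc)
      then show ?thesis
        using True x \<alpha>_cycle[OF x] two_le_m cycle_of_list_upt[of 2 m x]
        by (auto simp: transpose_def simp del: upt_Suc)
    next
      case False
      \<comment> \<open>The form \<open>Suc l\<close> brings \<open>[2..<k]\<close> into the shape
        of \<open>cycle_of_list_upt\<close>.\<close>
      then obtain l where l: "k = Suc l" "2 \<le> l" "l < m"
        using k by (cases k) auto
      have "\<alpha>\<^sub>k k x = cycle_of_list [2..<Suc l] (cycle_of_list [Suc l..<Suc m] x)"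
        using x False by (auto simp: \<alpha>\<^sub>k_def l(1) simp del: upt_Suc)
      also have "\<dots> = (if x = m then Suc l else if x = l then 2 else if x = 1 then 1 else Suc x)"
      proof -
        have "cycle_of_list [Suc l..<Suc m] x = (if x = m then Suc l else if l < x then Suc x else x)"
          using l x by (subst cycle_of_list_upt) auto
        then show ?thesis
          using l x by (subst cycle_of_list_upt) auto
      qed
      finally show ?thesis
        using False x l \<alpha>_cycle[OF x] by (auto simp: transpose_def)
    qed
  qed
qed

lemma \<alpha>\<^sub>k_one:
  assumes "k \<in> {1..m}"
  shows "\<alpha>\<^sub>k k 1 = 1"
  using assms by (auto simp: \<alpha>\<^sub>k_eq \<alpha>_one[simplified])

section \<open>The bijection between refinements\<close>

lemma one_k_in_conn:
  assumes "k \<in> {1..m}"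
  shows "(1, k) \<in> conn (graph_of \<alpha>)"
  using assms orbit_\<alpha>_one orbit_eq_conn[OF permutation(2)] by auto

text \<open>First (1,k) is peeled off both \<beta> and \<alpha>, unless k = 1. Now 1 is fixed by the
  refinement, so it may be detached from \<alpha> by (1,2); for k = 2 the first step has already
  done this.\<close>

lemma refines_phi:
  assumes k: "k \<in> {1..m}" and \<beta>: "\<beta> permutes {1..n}" "\<beta> 1 = k"
  shows "refines {1..n} \<beta> \<alpha> \<longleftrightarrow> refines {1..n} (transpose 1 k \<circ> \<beta>) (\<alpha>\<^sub>k k)"
proof -
  have one: "1 \<in> {1..n}" using m_le_n two_le_m by auto
  note \<alpha> = permutes(2)
  have merge: "refines {1..n} \<beta> \<alpha> \<longleftrightarrow> refines {1..n} (transpose 1 k \<circ> \<beta>) (transpose 1 k \<circ> \<alpha>)"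
    if "k \<noteq> 1"
    using refines_transpose[OF _ \<alpha> one _ _ \<beta>(1)] \<beta>(2) that one_k_in_conn[OF k] by auto
  consider "k = 1" | "k = 2" | "k \<ge> 3" using k by fastforce
  then show ?thesis
  proof cases
    case 1
    then show ?thesis
      using refines_transpose_fixed_point[OF _ \<alpha> one _ \<beta>(1)] \<beta>(2) \<alpha>_one \<alpha>\<^sub>k_eq[OF k] by simp
  next
    case 2
    then show ?thesis using merge \<alpha>\<^sub>k_eq[OF k] by simp
  next
    case 3
    have kn: "k \<in> {1..n}" using k m_le_n by auto
    have \<alpha>': "transpose 1 k \<circ> \<alpha> permutes {1..n}" "transpose 1 k \<circ> \<beta> permutes {1..n}"
      using permutes_compose[OF \<alpha> permutes_swap_id[OF one kn]]
        permutes_compose[OF \<beta>(1) permutes_swap_id[OF one kn]] by auto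
    \<comment> \<open>As k differs from 2, the image of 1 is still 2, so the transposition detaching
      1 is (1,2).\<close>
    have im: "(transpose 1 k \<circ> \<alpha>) 1 = 2" using 3 \<alpha>_one by simp
    have fix1: "(transpose 1 k \<circ> \<beta>) 1 = 1" using \<beta>(2) by simp
    have "refines {1..n} (transpose 1 k \<circ> \<beta>) (transpose 1 k \<circ> \<alpha>) \<longleftrightarrow>
        refines {1..n} (transpose 1 k \<circ> \<beta>) (transpose 1 2 \<circ> (transpose 1 k \<circ> \<alpha>))"
      by (rule refines_transpose_fixed_point[OF _ \<alpha>'(1) one _ \<alpha>'(2) fix1, unfolded im]) simp_all
    then show ?thesis using merge 3 \<alpha>\<^sub>k_eq[OF k] by simp
  qed
qed

text \<open>The map is its own inverse. Since \<open>\<alpha>\<^sub>k k\<close> fixes 1, so does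
  each of its refinements, and multiplying by (1,k) restores the value k at 1.\<close>

lemma bij_betw_refines_phi:
  assumes k: "k \<in> {1..m}"
  shows "bij_betw (\<lambda>\<beta>. transpose 1 k \<circ> \<beta>) {\<beta>. refines {1..n} \<beta> \<alpha> \<and> \<beta> 1 = k}
    {\<gamma>. refines {1..n} \<gamma> (\<alpha>\<^sub>k k)}"
proof (rule bij_betwI[where g = "\<lambda>\<gamma>. transpose 1 k \<circ> \<gamma>"])
  have one: "1 \<in> {1..n}" and kn: "k \<in> {1..n}" using k m_le_n two_le_m by auto
  show "(\<lambda>\<beta>. transpose 1 k \<circ> \<beta>) \<in> {\<beta>. refines {1..n} \<beta> \<alpha> \<and> \<beta> 1 = k}
      \<rightarrow> {\<gamma>. refines {1..n} \<gamma> (\<alpha>\<^sub>k k)}"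
  proof (intro funcsetI CollectI)
    fix \<beta> assume "\<beta> \<in> {\<beta>. refines {1..n} \<beta> \<alpha> \<and> \<beta> 1 = k}"
    then have "refines {1..n} \<beta> \<alpha>" "\<beta> 1 = k" "\<beta> permutes {1..n}"
      by (simp_all add: refines_def)
    then show "refines {1..n} (transpose 1 k \<circ> \<beta>) (\<alpha>\<^sub>k k)"
      using refines_phi[OF k] by blast
  qed
  show "(\<lambda>\<gamma>. transpose 1 k \<circ> \<gamma>) \<in> {\<gamma>. refines {1..n} \<gamma> (\<alpha>\<^sub>k k)}
      \<rightarrow> {\<beta>. refines {1..n} \<beta> \<alpha> \<and> \<beta> 1 = k}"
  proof (intro funcsetI CollectI)
    fix \<gamma> assume "\<gamma> \<in> {\<gamma>. refines {1..n} \<gamma> (\<alpha>\<^sub>k k)}"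
    then have R: "refines {1..n} \<gamma> (\<alpha>\<^sub>k k)" by simp
    have "permutation (\<alpha>\<^sub>k k)" using phi_permutes(2)[OF k] permutes_permutation by blast
    then have "\<gamma> 1 \<in> Orbits.orbit (\<alpha>\<^sub>k k) 1" using R one by (rule refines_in_orbit)
    then have "(transpose 1 k \<circ> \<gamma>) 1 = k"
      using \<alpha>\<^sub>k_one[OF k] orbit_eq_singleton_iff[of "\<alpha>\<^sub>k k" 1] by auto
    moreover have "transpose 1 k \<circ> \<gamma> permutes {1..n}"
      using R one kn by (auto simp: refines_def intro!: permutes_compose permutes_swap_id)
    ultimately show "refines {1..n} (transpose 1 k \<circ> \<gamma>) \<alpha> \<and> (transpose 1 k \<circ> \<gamma>) 1 = k"
      using refines_phi[OF k, of "transpose 1 k \<circ> \<gamma>"] R by (simp add: transpose_comp_cancel)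
  qed
qed (simp_all add: transpose_comp_cancel)

section \<open>Comparison of component numbers\<close>

lemma same_cycle_conn: "same_cycle \<sigma> x y \<longleftrightarrow> (x, y) \<in> conn (graph_of \<sigma>)"
  by (simp add: same_cycle_def orbit_eq_conn[OF permutation(1)])

lemma \<sigma>\<^sub>k_eq: "\<sigma>\<^sub>k k = (if same_cycle \<sigma> 1 k then \<sigma> else transpose 1 k \<circ> \<sigma>)"
  by (simp add: \<sigma>\<^sub>k_def)

text \<open>Both branches of the definition agree here: the edge (1,k) is redundant if 1 and k share
  a cycle of \<sigma>, and otherwise the transposition merges their cycles.\<close>

lemma conn_\<sigma>\<^sub>k: "conn (graph_of (\<sigma>\<^sub>k k)) = conn (insert (1, k) (graph_of \<sigma>))"
  using conn_graph_of_transpose[OF permutation(1), of 1 k] conn_insert_absorb[of 1 k "graph_of \<sigma>"]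
  by (simp add: \<sigma>\<^sub>k_eq same_cycle_conn)

text \<open>The edge (1,k), present in \<beta> because \<beta>(1) = k, is handed over to
  \<open>\<sigma>\<^sub>k k\<close>; together the two permutations generate the same
  connections.\<close>

lemma kappa_phi:
  assumes k: "k \<in> {1..m}" and \<beta>: "\<beta> permutes {1..n}" "\<beta> 1 = k"
  shows "kappa n (\<sigma>\<^sub>k k, transpose 1 k \<circ> \<beta>) = kappa n (\<sigma>, \<beta>)"
proof -
  let ?\<gamma> = "transpose 1 k \<circ> \<beta>"
  have "(1, k) \<in> conn (graph_of \<beta>)" using conn_graph_of[of 1 \<beta>] \<beta> by simp
  then have \<gamma>: "conn (insert (1, k) (graph_of ?\<gamma>)) = conn (graph_of \<beta>)"
    by (simp add: conn_insert_transpose conn_insert_absorb)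
  have "conn (graph_of (\<sigma>\<^sub>k k) \<union> graph_of ?\<gamma>) = conn (insert (1, k) (graph_of \<sigma>) \<union> graph_of ?\<gamma>)"
    by (rule conn_Un_cong[OF conn_\<sigma>\<^sub>k])
  also have "\<dots> = conn (insert (1, k) (graph_of ?\<gamma>) \<union> graph_of \<sigma>)"
    by (simp add: Un_commute)
  also have "\<dots> = conn (graph_of \<sigma> \<union> graph_of \<beta>)"
    using conn_Un_cong[OF \<gamma>, of "graph_of \<sigma>"] by (simp add: Un_commute)
  finally have "comps {1..n} (graph_of (\<sigma>\<^sub>k k) \<union> graph_of ?\<gamma>)
      = comps {1..n} (graph_of \<sigma> \<union> graph_of \<beta>)"
    by (rule comps_conn_cong)
  moreover have "?\<gamma> permutes {1..n}"
    using \<beta>(1) k m_le_n by (intro permutes_compose permutes_swap_id) auto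
  ultimately show ?thesis
    using kappa_eq_comps permutes(1) phi_permutes(1)[OF k] \<beta>(1) by metis
qed

text \<open>This bounds the exponent of \<open>u\<close> in the weight. Undoing
  \<open>\<alpha>\<^sub>k_eq\<close> takes the edges (1,k) and (1,2); the first is already supplied
  by \<open>\<sigma>\<^sub>k k\<close>, so only the second can cost a component.\<close>

lemma kappa_phi_le:
  assumes k: "k \<in> {1..m}"
  shows "kappa n (\<sigma>\<^sub>k k, \<alpha>\<^sub>k k) \<le> kappa n (\<sigma>, \<alpha>) + 1"
proof -
  let ?F = "graph_of (\<sigma>\<^sub>k k) \<union> graph_of (\<alpha>\<^sub>k k)"
  let ?E = "insert (1, 2) ?F"
  have \<sigma>k: "conn (graph_of (\<sigma>\<^sub>k k)) \<subseteq> conn ?E" by (rule conn_mono) auto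
  have e: "(1, k) \<in> conn (graph_of (\<sigma>\<^sub>k k))" "graph_of \<sigma> \<subseteq> conn (graph_of (\<sigma>\<^sub>k k))"
    unfolding conn_\<sigma>\<^sub>k by (auto intro!: conn_edge)
  have \<alpha>k: "conn (insert (1, 2) (graph_of (\<alpha>\<^sub>k k))) \<subseteq> conn ?E" by (rule conn_mono) auto
  have "graph_of \<alpha> \<subseteq> conn ?E"
  proof (cases "k \<in> {1, 2}")
    case True
    then have "\<alpha> = transpose 1 2 \<circ> \<alpha>\<^sub>k k"
      using \<alpha>\<^sub>k_eq[OF k] by (simp add: transpose_comp_cancel)
    then show ?thesis using graph_of_transpose_subset[of 1 2 "\<alpha>\<^sub>k k"] \<alpha>k by auto
  next
    case False
    let ?\<delta> = "transpose 1 2 \<circ> \<alpha>\<^sub>k k"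
    have "\<alpha> = transpose 1 k \<circ> ?\<delta>"
      using \<alpha>\<^sub>k_eq[OF k] False by (simp add: transpose_comp_cancel)
    then have "graph_of \<alpha> \<subseteq> conn (insert (1, k) (graph_of ?\<delta>))"
      using graph_of_transpose_subset[of 1 k ?\<delta>] by simp
    moreover have "insert (1, k) (graph_of ?\<delta>) \<subseteq> conn ?E"
      using graph_of_transpose_subset[of 1 2 "\<alpha>\<^sub>k k"] \<alpha>k \<sigma>k e(1) by auto
    then have "conn (insert (1, k) (graph_of ?\<delta>)) \<subseteq> conn ?E" by (rule conn_least)
    ultimately show ?thesis by blast
  qed
  then have "graph_of \<sigma> \<union> graph_of \<alpha> \<subseteq> conn ?E" using e(2) \<sigma>k by blast
  then have "card (comps {1..n} ?E) \<le> card (comps {1..n} (graph_of \<sigma> \<union> graph_of \<alpha>))"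
    by (rule card_comps_antimono[rotated]) simp
  moreover have "card (comps {1..n} ?F) \<le> card (comps {1..n} ?E) + 1"
    using m_le_n two_le_m by (intro card_comps_insert) auto
  ultimately show ?thesis
    using kappa_eq_comps[OF permutes] kappa_eq_comps[OF phi_permutes[OF k]] by linarith
qed

section \<open>Exponents and summation\<close>

text \<open>The exponent of \<open>u\<close> telescopes through
  \<open>kappa n (\<sigma>\<^sub>k k, \<alpha>\<^sub>k k)\<close>. For k other than 1, \<gamma> has
  one cycle more than \<beta>; a cycle lost by \<sigma> offsets this exactly if 1 and k lie on
  different cycles of \<sigma>, and otherwise a factor \<open>v\<close> remains.\<close>

lemma whitney_term_phi:
  fixes u v :: "'r::comm_ring_1"
  assumes k: "k \<in> {1..m}" and R: "refines {1..n} \<beta> \<alpha>" and \<beta>1: "\<beta> 1 = k"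
  defines "\<gamma> \<equiv> transpose 1 k \<circ> \<beta>"
  shows "u ^ (kappa n (\<sigma>, \<beta>) - kappa n (\<sigma>, \<alpha>)) *
      v ^ (kappa n (\<sigma>, \<beta>) + n - (num_cycles {1..n} \<beta> + num_cycles {1..n} \<sigma>)) =
    u ^ (kappa n (\<sigma>\<^sub>k k, \<gamma>) - kappa n (\<sigma>\<^sub>k k, \<alpha>\<^sub>k k)) *
      v ^ (kappa n (\<sigma>\<^sub>k k, \<gamma>) + n - (num_cycles {1..n} \<gamma> + num_cycles {1..n} (\<sigma>\<^sub>k k))) *
      weight n m k (\<sigma>, \<alpha>) u v"
proof -
  have one: "1 \<in> {1..n}" and kn: "k \<in> {1..n}" using k m_le_n two_le_m by auto
  have \<beta>: "\<beta> permutes {1..n}" using R by (simp add: refines_def)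
  have \<gamma>: "refines {1..n} \<gamma> (\<alpha>\<^sub>k k)" unfolding \<gamma>_def using refines_phi[OF k \<beta> \<beta>1] R by simp
  then have \<gamma>p: "\<gamma> permutes {1..n}" by (simp add: refines_def)
  have \<kappa>: "kappa n (\<sigma>\<^sub>k k, \<gamma>) = kappa n (\<sigma>, \<beta>)"
    unfolding \<gamma>_def using k \<beta> \<beta>1 by (rule kappa_phi)
  \<comment> \<open>The two inequalities make the telescoping valid for truncated
    subtraction.\<close>
  have "kappa n (\<sigma>\<^sub>k k, \<alpha>\<^sub>k k) \<le> kappa n (\<sigma>\<^sub>k k, \<gamma>)"
    using phi_permutes[OF k] \<gamma> by (rule kappa_refines_le)
  moreover have "kappa n (\<sigma>, \<alpha>) \<le> kappa n (\<sigma>\<^sub>k k, \<alpha>\<^sub>k k)"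
    using kappa_le_kappa_phi[OF coll cyc k two_le_m] unfolding phi_eq .
  ultimately have u: "kappa n (\<sigma>, \<beta>) - kappa n (\<sigma>, \<alpha>) =
      (kappa n (\<sigma>\<^sub>k k, \<gamma>) - kappa n (\<sigma>\<^sub>k k, \<alpha>\<^sub>k k)) + (kappa n (\<sigma>\<^sub>k k, \<alpha>\<^sub>k k) - kappa n (\<sigma>, \<alpha>))"
    using \<kappa> by linarith
  have z\<beta>: "num_cycles {1..n} \<gamma> = num_cycles {1..n} \<beta> + 1" if "k \<noteq> 1"
    unfolding \<gamma>_def \<beta>1[symmetric] using that \<beta>1 \<beta> one by (intro num_cycles_transpose_image) auto
  have z\<sigma>: "num_cycles {1..n} \<sigma> = num_cycles {1..n} (\<sigma>\<^sub>k k) + 1" if "\<not> same_cycle \<sigma> 1 k"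
    using that num_cycles_transpose_merge[OF _ permutes(1) one kn]
    by (simp add: \<sigma>\<^sub>k_eq same_cycle_conn)
  \<comment> \<open>Without truncation on the \<gamma> side, the extra cycle of \<gamma> really
    lowers the exponent of \<open>v\<close> by one.\<close>
  have le: "num_cycles {1..n} \<gamma> + num_cycles {1..n} (\<sigma>\<^sub>k k) \<le> kappa n (\<sigma>\<^sub>k k, \<gamma>) + n"
    using phi_permutes(1)[OF k] \<gamma>p by (rule num_cycles_add_le_kappa)
  have refl: "same_cycle \<sigma> 1 1" by (simp add: same_cycle_conn)
  have v: "kappa n (\<sigma>, \<beta>) + n - (num_cycles {1..n} \<beta> + num_cycles {1..n} \<sigma>) =
      kappa n (\<sigma>\<^sub>k k, \<gamma>) + n - (num_cycles {1..n} \<gamma> + num_cycles {1..n} (\<sigma>\<^sub>k k)) +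
      (if k \<noteq> 1 \<and> same_cycle \<sigma> 1 k then 1 else 0)"
  proof (cases "k = 1")
    case True
    then show ?thesis using refl by (simp add: \<gamma>_def \<kappa>[unfolded \<gamma>_def] \<sigma>\<^sub>k_eq)
  next
    case False
    show ?thesis
    proof (cases "same_cycle \<sigma> 1 k")
      case True
      then have "\<sigma>\<^sub>k k = \<sigma>" by (simp add: \<sigma>\<^sub>k_eq)
      then show ?thesis using True False z\<beta> le \<kappa> by simp
    next
      case sc: False
      then show ?thesis using False z\<beta> z\<sigma> le \<kappa> by simp
    qed
  qed
  have "weight n m k (\<sigma>, \<alpha>) u v = u ^ (kappa n (\<sigma>\<^sub>k k, \<alpha>\<^sub>k k) - kappa n (\<sigma>, \<alpha>)) *
      v ^ (if k \<noteq> 1 \<and> same_cycle \<sigma> 1 k then 1 else 0)"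
    by (simp add: phi_eq del: phi.simps kappa.simps)
  then show ?thesis unfolding u v by (simp add: power_add mult_ac del: kappa.simps weight.simps)
qed

lemma whitney_recursion:
  fixes u v :: "'r::comm_ring_1"
  shows "whitney n (\<sigma>, \<alpha>) u v =
    (\<Sum>k = 1..m. whitney n (phi m k (\<sigma>, \<alpha>)) u v * weight n m k (\<sigma>, \<alpha>) u v)"
proof -
  let ?R = "{\<beta>. refines {1..n} \<beta> \<alpha>}"
  let ?t = "\<lambda>\<sigma> \<alpha> \<beta>. u ^ (kappa n (\<sigma>, \<beta>) - kappa n (\<sigma>, \<alpha>)) *
    v ^ (kappa n (\<sigma>, \<beta>) + n - (num_cycles {1..n} \<beta> + num_cycles {1..n} \<sigma>))"
  have fin: "finite ?R"
    by (rule finite_subset[OF _ finite_permutations[of "{1..n}"]]) (auto simp: refines_def)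
  have "1 \<in> {1..n}" using m_le_n two_le_m by auto
  then have im: "(\<lambda>\<beta>. \<beta> 1) ` ?R \<subseteq> {1..m}"
    using refines_in_orbit[OF permutation(2)] orbit_\<alpha>_one by blast
  have "whitney n (\<sigma>, \<alpha>) u v = (\<Sum>\<beta>\<in>?R. ?t \<sigma> \<alpha> \<beta>)" by (simp del: kappa.simps)
  also have "\<dots> = (\<Sum>k = 1..m. \<Sum>\<beta> | \<beta> \<in> ?R \<and> \<beta> 1 = k. ?t \<sigma> \<alpha> \<beta>)"
    by (rule sum.group[OF fin finite_atLeastAtMost im, symmetric])
  also have "\<dots> = (\<Sum>k = 1..m. whitney n (phi m k (\<sigma>, \<alpha>)) u v * weight n m k (\<sigma>, \<alpha>) u v)"
  proof (rule sum.cong[OF refl])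
    fix k assume k: "k \<in> {1..m}"
    let ?w = "weight n m k (\<sigma>, \<alpha>) u v"
    have "(\<Sum>\<beta> | \<beta> \<in> ?R \<and> \<beta> 1 = k. ?t \<sigma> \<alpha> \<beta>)
        = (\<Sum>\<beta> | \<beta> \<in> ?R \<and> \<beta> 1 = k. ?t (\<sigma>\<^sub>k k) (\<alpha>\<^sub>k k) (transpose 1 k \<circ> \<beta>) * ?w)"
    proof (rule sum.cong[OF refl])
      fix \<beta> assume "\<beta> \<in> {\<beta>. \<beta> \<in> ?R \<and> \<beta> 1 = k}"
      then show "?t \<sigma> \<alpha> \<beta> = ?t (\<sigma>\<^sub>k k) (\<alpha>\<^sub>k k) (transpose 1 k \<circ> \<beta>) * ?w"
        using whitney_term_phi[OF k] by blast
    qed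
    \<comment> \<open>The weight depends on k alone, so it is carried along as a constant
      factor.\<close>
    also have "\<dots> = (\<Sum>\<gamma> | refines {1..n} \<gamma> (\<alpha>\<^sub>k k). ?t (\<sigma>\<^sub>k k) (\<alpha>\<^sub>k k) \<gamma> * ?w)"
      using sum.reindex_bij_betw[OF bij_betw_refines_phi[OF k],
          of "\<lambda>\<gamma>. ?t (\<sigma>\<^sub>k k) (\<alpha>\<^sub>k k) \<gamma> * ?w"] by simp
    also have "\<dots> = whitney n (phi m k (\<sigma>, \<alpha>)) u v * ?w"
      by (simp add: phi_eq sum_distrib_right del: kappa.simps phi.simps weight.simps)
    finally show "(\<Sum>\<beta> | \<beta> \<in> ?R \<and> \<beta> 1 = k. ?t \<sigma> \<alpha> \<beta>) = whitney n (phi m k (\<sigma>, \<alpha>)) u v * ?w" .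
  qed
  finally show ?thesis .
qed

text \<open>By \<open>kappa_phi_le\<close> the exponent of \<open>u\<close> is at most one, and
  \<open>v\<close> occurs at most once.\<close>

lemma weight_monomial:
  fixes u v :: "'r::comm_ring_1"
  assumes k: "k \<in> {1..m}"
  shows "weight n m k (\<sigma>, \<alpha>) u v \<in> {1, u, v, u * v}"
proof -
  have "kappa n (phi m k (\<sigma>, \<alpha>)) - kappa n (\<sigma>, \<alpha>) \<in> {0, 1}"
    using kappa_phi_le[OF k] unfolding phi_eq by auto
  then show ?thesis by (auto simp del: phi.simps kappa.simps)
qed

end

theorem theorem2p8:
  fixes n m :: nat and \<sigma> \<alpha> :: "nat \<Rightarrow> nat" and u v :: "'r::comm_ring_1"
  assumes "collection_of_hypermaps n (\<sigma>, \<alpha>)"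
    and "m \<ge> 2"
    and "has_cycle \<alpha> [1..<Suc m]"
  shows "whitney n (\<sigma>, \<alpha>) u v =
           (\<Sum>k = 1..m. whitney n (phi m k (\<sigma>, \<alpha>)) u v * weight n m k (\<sigma>, \<alpha>) u v) \<and>
         (\<forall>k\<in>{1..m}. weight n m k (\<sigma>, \<alpha>) u v \<in> {1, u, v, u * v})"
proof -
  interpret hypermaps_with_cycle n m \<sigma> \<alpha>
    using assms by unfold_locales
  show ?thesis using whitney_recursion weight_monomial by blast
qed

end
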